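(* Let $\psi$ be an Orlicz function and let $k\ge1$ be an integer. Then the Dirac operator $D$ maps $W^{k,\psi}(\Omega,Cl_n)$ into $W^{k-1,\psi}(\Omega,Cl_n)$, and there is a positive constant $\gamma=\gamma(n,\psi,\Omega)$ such that $$\|Df\|_{W^{k-1,\psi}(\Omega,Cl_n)}\le\gamma\,\|f\|_{W^{k,\psi}(\Omega,Cl_n)}\qquad\text{for all } f\in W^{k,\psi}(\Omega,Cl_n).$$
   Context: $\Omega$ is a bounded smooth domain of $\mathbb{R}^n$ whose boundary is at least a $C^1$-hypersurface. $Cl_n$ is the real $2^n$-dimensional Clifford algebra generated by an orthonormal basis $e_1,\dots,e_n$ of $\mathbb{R}^n$ with $e_ie_j+e_je_i=-2\delta_{ij}e_0$, where $e_0$ is the identity; it has basis $\{e_A: A\subset\{1<\dots<n\}\}$. A function $f:\Omega\to Cl_n$ is written $f=\sum_A e_Af_A$ with real-valued components $f_A$. The Dirac operator is $Df=\sum_{j=1}^n e_j\partial_{x_j}f$, with weak derivatives. An Orlicz function is a function $\psi:[0,\infty)\to[0,\infty)$ that is increasing and convex, with $\psi(0)=0$ and $\lim_{x\to\infty}\psi(x)=\infty$. For an integer $k\ge 0$, $W^{k,\psi}(\Omega,Cl_n)$ is the set of locally integrable $f:\Omega\to Cl_n$ such that for every $A$ there is $\beta_A>0$ with $\sum_{0\le|\alpha|\le k}\int_\Omega\psi(|D^\alpha f_A(x)|/\beta_A)\,dx<\infty$, where $D^\alpha$ is the weak partial derivative of multi-index $\alpha$; its norm is $\|f\|_{W^{k,\psi}(\Omega,Cl_n)}=\sum_A\|f_A\|_{W^{k,\psi}(\Omega,\mathbb{R})}$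 with $$\|f_A\|_{W^{k,\psi}(\Omega,\mathbb{R})}=\inf\Big\{\beta>0:\sum_{0\le|\alpha|\le k}\int_\Omega\psi\big(|D^\alpha f_A(x)|/\beta\big)\,dx\le1\Big\}.$$ *)

theory Defs
  imports "HOL-Analysis.Analysis"
begin

section \<open>The Clifford algebra\<close>

text \<open>
  With \<open>n = CARD('n)\<close>, the algebra \<open>Cl\<^sub>n\<close> is realised on its basis \<open>(e\<^sub>A)\<close> indexed by the subsets
  \<open>A\<close> of the ordered index type \<open>'n\<close>: \<open>e\<^sub>A = axis A 1\<close> and \<open>x $ A\<close> is the component \<open>x\<^sub>A\<close>.  Caution: the
  class operation \<open>*\<close> on this type is the componentwise product, not the Clifford product.
\<close>

type_synonym 'n clifford = "real ^ ('n set)"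

text \<open>
  Sorting the word \<open>e\<^sub>a\<^sub>1 \<dots> e\<^sub>a\<^sub>r e\<^sub>b\<^sub>1 \<dots> e\<^sub>b\<^sub>s\<close> gives one factor \<open>-1\<close> for each transposition
  (\<open>b < a\<close>) and one for each cancellation \<open>e\<^sub>a e\<^sub>a = -1\<close> (\<open>b = a\<close>).
\<close>

definition cl_sign :: "'n::{finite,linorder} set \<Rightarrow> 'n set \<Rightarrow> real" where
  "cl_sign A B = (- 1) ^ card {(a, b). a \<in> A \<and> b \<in> B \<and> b \<le> a}"

definition cl_mult :: "'n::{finite,linorder} clifford \<Rightarrow> 'n clifford \<Rightarrow> 'n clifford" (infixl "\<odot>" 70) where
  "x \<odot> y = (\<Sum>A\<in>UNIV. \<Sum>B\<in>UNIV. (x $ A * y $ B * cl_sign A B) *\<^sub>R axis (sym_diff A B) 1)"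

definition cl_one :: "'n::{finite,linorder} clifford" where
  "cl_one = axis {} 1"

definition cl_gen :: "'n \<Rightarrow> 'n::{finite,linorder} clifford" where
  "cl_gen j = axis {j} 1"

text \<open>
  The following facts identify the above product as that of \<open>Cl\<^sub>n\<close>: it is bilinear, associative and
  unital, the generators satisfy \<open>e\<^sub>i e\<^sub>j + e\<^sub>j e\<^sub>i = -2 \<delta>\<^sub>i\<^sub>j e\<^sub>0\<close>, and \<open>e\<^sub>A\<close> is the product of the generators
  indexed by \<open>A\<close> in increasing order.
\<close>

lemma bilinear_cl_mult: "bilinear cl_mult"
  unfolding bilinear_def
  by (auto intro!: linearI simp: cl_mult_def algebra_simps sum.distrib scaleR_sum_right scaleR_left_distrib)

lemma cl_mult_axis:
  "axis A 1 \<odot> axis B 1 = cl_sign A B *\<^sub>R axis (sym_diff A B) 1"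
proof -
  have "axis A 1 \<odot> axis B 1 =
      (\<Sum>A'\<in>UNIV. if A' = A then (\<Sum>B'\<in>UNIV. if B' = B then cl_sign A B *\<^sub>R axis (sym_diff A B) 1 else 0) else 0)"
    unfolding cl_mult_def
  proof (rule sum.cong [OF refl])
    fix A'
    have "(\<Sum>B'\<in>UNIV. (axis A 1 $ A' * axis B 1 $ B' * cl_sign A' B') *\<^sub>R axis (sym_diff A' B') (1::real)) =
      (\<Sum>B'\<in>UNIV. if A' = A \<and> B' = B then cl_sign A B *\<^sub>R axis (sym_diff A B) 1 else 0)"
      by (rule sum.cong [OF refl]) (simp add: axis_def [of A] axis_def [of B])
    then show "(\<Sum>B'\<in>UNIV. (axis A 1 $ A' * axis B 1 $ B' * cl_sign A' B') *\<^sub>R axis (sym_diff A' B') (1::real)) =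
      (if A' = A then (\<Sum>B'\<in>UNIV. if B' = B then cl_sign A B *\<^sub>R axis (sym_diff A B) 1 else 0) else 0)"
      by (cases "A' = A") simp_all
  qed
  then show ?thesis by simp
qed

lemma cl_sign_prod: "cl_sign A B = (\<Prod>a\<in>A. \<Prod>b\<in>B. if b \<le> a then - 1 else 1)"
proof -
  have "(\<Prod>a\<in>A. \<Prod>b\<in>B. if b \<le> a then - 1 else 1 :: real)
      = (\<Prod>p\<in>A \<times> B. if snd p \<le> fst p then - 1 else 1)"
    by (simp add: prod.cartesian_product case_prod_beta)
  also have "\<dots> = (\<Prod>p\<in>(A \<times> B) \<inter> {p. snd p \<le> fst p}. - 1)"
    by (subst prod.inter_restrict) (auto intro!: prod.cong)
  also have "(A \<times> B) \<inter> {p. snd p \<le> fst p} = {(a, b). a \<in> A \<and> b \<in> B \<and> b \<le> a}"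
    by auto
  finally show ?thesis by (simp add: cl_sign_def)
qed

lemma prod_sym_diff:
  fixes f :: "'a::finite \<Rightarrow> real"
  assumes "\<And>x. f x * f x = 1"
  shows "prod f (sym_diff A B) = prod f A * prod f B"
proof -
  have A: "prod f A = prod f (A - B) * prod f (A \<inter> B)"
    by (subst prod.union_disjoint [symmetric]) (auto intro!: prod.cong)
  have B: "prod f B = prod f (B - A) * prod f (A \<inter> B)"
    by (subst prod.union_disjoint [symmetric]) (auto intro!: prod.cong)
  have "prod f (A \<inter> B) * prod f (A \<inter> B) = 1"
    by (simp add: prod.distrib [symmetric] assms)
  then have "prod f A * prod f B = prod f (A - B) * prod f (B - A)"
    unfolding A B by (metis mult.assoc mult.commute mult.right_neutral)
  also have "\<dots> = prod f (sym_diff A B)"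
    by (subst prod.union_disjoint) auto
  finally show ?thesis ..
qed

lemma cl_sign_sym_diff_left: "cl_sign (sym_diff A B) C = cl_sign A C * cl_sign B C"
  unfolding cl_sign_prod
  by (rule prod_sym_diff) (auto simp: prod.distrib [symmetric] intro!: prod.neutral)

lemma cl_sign_sym_diff_right: "cl_sign A (sym_diff B C) = cl_sign A B * cl_sign A C"
  unfolding cl_sign_prod by (simp add: prod.distrib [symmetric] prod_sym_diff)

lemma linear_eq_axis:
  fixes f g :: "real ^ 'm \<Rightarrow> 'b::real_vector"
  assumes "linear f" "linear g" "\<And>i. f (axis i 1) = g (axis i 1)"
  shows "f x = g x"
proof -
  have "f = g"
    by (rule linear_eq_stdbasis) (use assms in \<open>auto simp: Basis_vec_def\<close>)
  then show ?thesis by simp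
qed

lemma cl_mult_assoc: "(x \<odot> y) \<odot> z = x \<odot> (y \<odot> z)"
proof -
  interpret bounded_bilinear cl_mult
    using bilinear_cl_mult by (simp add: bilinear_conv_bounded_bilinear)
  have basis: "(axis A 1 \<odot> axis B 1) \<odot> axis C 1 = axis A 1 \<odot> (axis B 1 \<odot> axis C 1)"
    for A B C :: "'a set"
  proof -
    have "sym_diff (sym_diff A B) C = sym_diff A (sym_diff B C)" by auto
    then show ?thesis
      by (simp only: cl_mult_axis scaleR_left scaleR_right scaleR_scaleR
          cl_sign_sym_diff_left cl_sign_sym_diff_right mult_ac)
  qed
  have 1: "(axis A 1 \<odot> axis B 1) \<odot> z = axis A 1 \<odot> (axis B 1 \<odot> z)" for A B
    by (rule linear_eq_axis [of _ _ z]) (auto intro!: linearI simp: basis add_left add_right scaleR_left scaleR_right)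
  have 2: "(axis A 1 \<odot> y) \<odot> z = axis A 1 \<odot> (y \<odot> z)" for A
    by (rule linear_eq_axis [of _ _ y]) (auto intro!: linearI simp: 1 add_left add_right scaleR_left scaleR_right)
  show ?thesis
    by (rule linear_eq_axis [of _ _ x]) (auto intro!: linearI simp: 2 add_left add_right scaleR_left scaleR_right)
qed

lemma cl_mult_one: "cl_one \<odot> x = x" "x \<odot> cl_one = x"
proof -
  interpret bounded_bilinear cl_mult
    using bilinear_cl_mult by (simp add: bilinear_conv_bounded_bilinear)
  show "cl_one \<odot> x = x" "x \<odot> cl_one = x"
    by (rule linear_eq_axis [of _ _ x],
        auto intro!: linearI simp: add_left add_right scaleR_left scaleR_right
          cl_one_def cl_mult_axis cl_sign_def)+
qed

lemma cl_gen_anticommute: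
  "cl_gen i \<odot> cl_gen j + cl_gen j \<odot> cl_gen i = (if i = j then - 2 else 0) *\<^sub>R cl_one"
proof (cases "i = j")
  case True
  have "cl_gen j \<odot> cl_gen j = - cl_one"
    by (simp add: cl_gen_def cl_one_def cl_mult_axis cl_sign_prod)
  with True show ?thesis by (simp add: vec_eq_iff)
next
  case False
  have sign: "cl_sign {a} {b} = (if b \<le> a then - 1 else 1)" for a b :: 'a
    by (simp add: cl_sign_prod)
  have "sym_diff {i} {j} = sym_diff {j} {i}"
    by (rule Un_commute)
  then have "cl_gen i \<odot> cl_gen j + cl_gen j \<odot> cl_gen i
      = (cl_sign {i} {j} + cl_sign {j} {i}) *\<^sub>R axis (sym_diff {i} {j}) 1"
    by (simp only: cl_gen_def cl_mult_axis scaleR_left_distrib)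
  also have "cl_sign {i} {j} + cl_sign {j} {i} = 0"
    using False by (auto simp: sign)
  finally show ?thesis using False by simp
qed

lemma axis_insert_greatest:
  assumes "\<And>a. a \<in> A \<Longrightarrow> a < j"
  shows "axis (insert j A) 1 = axis A 1 \<odot> cl_gen j"
proof -
  have "cl_sign A {j} = 1"
    using assms by (force simp: cl_sign_prod intro!: prod.neutral)
  moreover have "sym_diff A {j} = insert j A"
    using assms by auto
  ultimately show ?thesis by (simp add: cl_gen_def cl_mult_axis)
qed


section \<open>Weak derivatives\<close>

type_synonym 'n euclid = "(real, 'n) vec"

definition partial :: "'n::finite \<Rightarrow> ('n euclid \<Rightarrow> real) \<Rightarrow> 'n euclid \<Rightarrow> real" where
  "partial j \<phi> x = frechet_derivative \<phi> (at x) (axis j 1)"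

text \<open>Every iterated partial derivative being differentiable makes all of them continuous,
  so this is the class of infinitely differentiable functions.\<close>

definition smooth :: "('n::finite euclid \<Rightarrow> real) \<Rightarrow> bool" where
  "smooth \<phi> \<longleftrightarrow> (\<forall>js. foldr partial js \<phi> differentiable_on UNIV)"

definition test_function :: "'n::finite euclid set \<Rightarrow> ('n euclid \<Rightarrow> real) \<Rightarrow> bool" where
  "test_function \<Omega> \<phi> \<longleftrightarrow>
     smooth \<phi> \<and> compact (closure {x. \<phi> x \<noteq> 0}) \<and> closure {x. \<phi> x \<noteq> 0} \<subseteq> \<Omega>"

type_synonym 'n multi_index = "'n \<Rightarrow> nat"

abbreviation order_of :: "'n::finite multi_index \<Rightarrow> nat" where
  "order_of \<alpha> \<equiv> (\<Sum>j\<in>UNIV. \<alpha> j)"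

definition unit_index :: "'n \<Rightarrow> 'n multi_index" where
  "unit_index j = (\<lambda>i. if i = j then 1 else 0)"

text \<open>The order in which the directions are processed is immaterial for smooth functions.\<close>

definition partials :: "'n::{finite,linorder} multi_index \<Rightarrow> ('n euclid \<Rightarrow> real) \<Rightarrow> 'n euclid \<Rightarrow> real" where
  "partials \<alpha> = foldr (\<lambda>j. partial j ^^ \<alpha> j) (sorted_list_of_set UNIV)"

definition locally_integrable ::
    "'n::finite euclid set \<Rightarrow> ('n euclid \<Rightarrow> 'b::{banach,second_countable_topology}) \<Rightarrow> bool" where
  "locally_integrable \<Omega> u \<longleftrightarrow> (\<forall>K. compact K \<and> K \<subseteq> \<Omega> \<longrightarrow> set_integrable lebesgue K u)"

definition has_weak_deriv ::
    "'n::{finite,linorder} euclid set \<Rightarrow> 'n multi_index \<Rightarrow> ('n euclid \<Rightarrow> real) \<Rightarrow> ('n euclid \<Rightarrow> real) \<Rightarrow> bool" where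
  "has_weak_deriv \<Omega> \<alpha> u v \<longleftrightarrow>
     locally_integrable \<Omega> u \<and> locally_integrable \<Omega> v \<and>
     (\<forall>\<phi>. test_function \<Omega> \<phi> \<longrightarrow>
        (LINT x:\<Omega>|lebesgue. u x * partials \<alpha> \<phi> x)
          = (- 1) ^ order_of \<alpha> * (LINT x:\<Omega>|lebesgue. v x * \<phi> x))"

text \<open>A representative of the weak derivative, which is determined only up to null sets;
  it is meaningful only where a weak derivative exists.\<close>

definition weak_deriv ::
    "'n::{finite,linorder} euclid set \<Rightarrow> 'n multi_index \<Rightarrow> ('n euclid \<Rightarrow> real) \<Rightarrow> 'n euclid \<Rightarrow> real" where
  "weak_deriv \<Omega> \<alpha> u = (SOME v. has_weak_deriv \<Omega> \<alpha> u v)"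

definition cl_weak_partial ::
    "'n::{finite,linorder} euclid set \<Rightarrow> 'n \<Rightarrow> ('n euclid \<Rightarrow> 'n clifford) \<Rightarrow> 'n euclid \<Rightarrow> 'n clifford" where
  "cl_weak_partial \<Omega> j f x = (\<Sum>A\<in>UNIV. weak_deriv \<Omega> (unit_index j) (\<lambda>y. f y $ A) x *\<^sub>R axis A 1)"

definition dirac ::
    "'n::{finite,linorder} euclid set \<Rightarrow> ('n euclid \<Rightarrow> 'n clifford) \<Rightarrow> 'n euclid \<Rightarrow> 'n clifford" where
  "dirac \<Omega> f x = (\<Sum>j\<in>UNIV. cl_gen j \<odot> cl_weak_partial \<Omega> j f x)"


section \<open>Orlicz--Sobolev spaces\<close>

text \<open>Only the values of \<open>\<psi>\<close> on \<open>[0, \<infinity>)\<close> matter.\<close>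

definition orlicz :: "(real \<Rightarrow> real) \<Rightarrow> bool" where
  "orlicz \<psi> \<longleftrightarrow> (\<forall>x\<ge>0. 0 \<le> \<psi> x) \<and> mono_on {0..} \<psi> \<and> convex_on {0..} \<psi> \<and>
     \<psi> 0 = 0 \<and> filterlim \<psi> at_top at_top"

definition modular ::
    "'n::{finite,linorder} euclid set \<Rightarrow> (real \<Rightarrow> real) \<Rightarrow> nat \<Rightarrow> ('n euclid \<Rightarrow> real) \<Rightarrow> real \<Rightarrow> ennreal" where
  "modular \<Omega> \<psi> k u \<beta> =
     (\<Sum>\<alpha> | order_of \<alpha> \<le> k. \<integral>\<^sup>+x\<in>\<Omega>. ennreal (\<psi> (\<bar>weak_deriv \<Omega> \<alpha> u x\<bar> / \<beta>)) \<partial>lebesgue)"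

definition orlicz_sobolev ::
    "nat \<Rightarrow> (real \<Rightarrow> real) \<Rightarrow> 'n::{finite,linorder} euclid set \<Rightarrow> ('n euclid \<Rightarrow> 'n clifford) set" where
  "orlicz_sobolev k \<psi> \<Omega> = {f. locally_integrable \<Omega> f \<and>
     (\<forall>A. (\<forall>\<alpha>. order_of \<alpha> \<le> k \<longrightarrow> (\<exists>v. has_weak_deriv \<Omega> \<alpha> (\<lambda>x. f x $ A) v)) \<and>
          (\<exists>\<beta>>0. modular \<Omega> \<psi> k (\<lambda>x. f x $ A) \<beta> < \<infinity>))}"

definition luxemburg_norm ::
    "nat \<Rightarrow> (real \<Rightarrow> real) \<Rightarrow> 'n::{finite,linorder} euclid set \<Rightarrow> ('n euclid \<Rightarrow> real) \<Rightarrow> real" where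
  "luxemburg_norm k \<psi> \<Omega> u = Inf {\<beta>. 0 < \<beta> \<and> modular \<Omega> \<psi> k u \<beta> \<le> 1}"

definition orlicz_sobolev_norm ::
    "nat \<Rightarrow> (real \<Rightarrow> real) \<Rightarrow> 'n::{finite,linorder} euclid set \<Rightarrow> ('n euclid \<Rightarrow> 'n clifford) \<Rightarrow> real" where
  "orlicz_sobolev_norm k \<psi> \<Omega> f = (\<Sum>A\<in>UNIV. luxemburg_norm k \<psi> \<Omega> (\<lambda>x. f x $ A))"


section \<open>Domains\<close>

definition C1_hypersurface :: "'a::euclidean_space set \<Rightarrow> bool" where
  "C1_hypersurface S \<longleftrightarrow> (\<forall>p\<in>S. \<exists>U \<rho> \<rho>'. open U \<and> p \<in> U \<and>
     (\<forall>x\<in>U. GDERIV \<rho> x :> \<rho>' x \<and> \<rho>' x \<noteq> 0) \<and> continuous_on U \<rho>' \<and>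
     S \<inter> U = {x\<in>U. \<rho> x = 0})"

definition bounded_C1_domain :: "'a::euclidean_space set \<Rightarrow> bool" where
  "bounded_C1_domain \<Omega> \<longleftrightarrow>
     \<Omega> \<noteq> {} \<and> open \<Omega> \<and> connected \<Omega> \<and> bounded \<Omega> \<and> C1_hypersurface (frontier \<Omega>)"

end

theory Submission
  imports Defs
begin

text \<open>
  The component of index \<open>B\<close> of \<open>Df\<close> is \<open>\<Sum>\<^sub>j \<plusminus> \<partial>\<^sub>j f\<^sub>A\<close> with \<open>A = {j} \<triangle> B\<close>, because multiplying a
  basis vector by \<open>e\<^sub>j\<close> only permutes the basis up to sign (\<open>dirac_component\<close>).  If every \<open>f\<^sub>A\<close> has weak
  derivatives up to order \<open>k\<close>, then \<open>D\<^sup>\<alpha> (Df)\<^sub>B = \<Sum>\<^sub>j \<plusminus> D\<^sup>\<alpha>\<^sup>+\<^sup>j f\<^sub>A\<close> for \<open>\<bar>\<alpha>\<bar> \<le> k - 1\<close>.  As \<open>\<alpha> \<mapsto> \<alpha> + j\<close> is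
  injective, the modular of \<open>\<partial>\<^sub>j f\<^sub>A\<close> of order \<open>k - 1\<close> is a part of the sum defining the modular of \<open>f\<^sub>A\<close> of
  order \<open>k\<close> (\<open>modular_first_derivative_le\<close>), so \<open>\<partial>\<^sub>j\<close> does not increase the Luxemburg norm.  Convexity of
  \<open>\<psi>\<close> gives the triangle inequality for that norm (\<open>modular_sum_le_1\<close>, \<open>luxemburg_norm_sum_le\<close>), hence
  \<open>\<parallel>(Df)\<^sub>B\<parallel> \<le> \<Sum>\<^sub>j \<parallel>f\<^sub>A\<parallel>\<close>.  For fixed \<open>j\<close> the map \<open>B \<mapsto> {j} \<triangle> B\<close> is a bijection, so summing over \<open>B\<close>
  counts every \<open>\<parallel>f\<^sub>A\<parallel>\<close> exactly \<open>n\<close> times and \<open>\<gamma> = n\<close> works for every order \<open>k\<close>.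

  Two facts about weak derivatives carry this argument.  The first is that \<open>D\<^sup>\<alpha>\<^sup>+\<^sup>j u\<close> is the \<open>\<alpha>\<close>-th weak derivative
  of \<open>\<partial>\<^sub>j u\<close> (\<open>has_weak_deriv_first_order_then\<close>); it comes from testing \<open>\<partial>\<^sub>j u\<close> against \<open>\<partial>\<^sup>\<alpha> \<phi>\<close>, and
  needs the symmetry of mixed partial derivatives of the test function (\<open>partial_commute\<close>).  The second
  is that weak derivatives are unique almost everywhere (\<open>has_weak_deriv_unique\<close>), so that the modular,
  which is built from a chosen representative, may be computed from any other one (\<open>modular_eq\<close>).
  Uniqueness is the fundamental lemma of the calculus of variations, for which smooth functions with
  support in a box are made from \<open>exp (- 1 / t)\<close>.
\<close>

section \<open>Mixed partial derivatives of smooth functions\<close>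

lemma smooth_partial: "smooth \<phi> \<Longrightarrow> smooth (partial j \<phi>)"
proof -
  assume "smooth \<phi>"
  then have "foldr partial (js @ [j]) \<phi> differentiable_on UNIV" for js
    unfolding smooth_def by blast
  then show ?thesis by (simp add: smooth_def)
qed

lemma smooth_partial_funpow: "smooth \<phi> \<Longrightarrow> smooth ((partial j ^^ m) \<phi>)"
  by (induction m) (auto intro: smooth_partial)

lemma smooth_differentiable: "smooth \<phi> \<Longrightarrow> \<phi> differentiable (at x)"
  unfolding smooth_def differentiable_on_def by (metis UNIV_I foldr_Nil id_apply)

lemma smooth_continuous: "smooth \<phi> \<Longrightarrow> continuous_on UNIV \<phi>"
  by (meson continuous_at_imp_continuous_on differentiable_imp_continuous_within smooth_differentiable)

lemma partial_eq:
  assumes "(\<phi> has_derivative \<phi>') (at x)"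
  shows "partial j \<phi> x = \<phi>' (axis j 1)"
  using frechet_derivative_at[OF assms] by (simp add: partial_def)

lemma partial_along_line:
  assumes "smooth \<phi>"
  shows "((\<lambda>t. \<phi> (x + t *\<^sub>R axis j 1)) has_real_derivative partial j \<phi> (x + t *\<^sub>R axis j 1)) (at t)"
proof -
  let ?y = "x + t *\<^sub>R axis j 1"
  have D: "(\<phi> has_derivative frechet_derivative \<phi> (at ?y)) (at ?y)"
    using smooth_differentiable[OF assms] by (simp add: frechet_derivative_works)
  have "((\<lambda>t. \<phi> (x + t *\<^sub>R axis j 1)) has_derivative
      (\<lambda>h. frechet_derivative \<phi> (at ?y) (h *\<^sub>R axis j 1))) (at t)"
    by (rule has_derivative_compose[where g = \<phi>]) (auto intro!: derivative_eq_intros D)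
  moreover have "(\<lambda>h. frechet_derivative \<phi> (at ?y) (h *\<^sub>R axis j 1)) = (*) (partial j \<phi> ?y)"
    using linear_scale[OF has_derivative_linear[OF D]] by (auto simp: partial_def)
  ultimately show ?thesis by (simp add: has_field_derivative_def)
qed

text \<open>Apply the mean value theorem first in direction \<open>i\<close> to the difference in direction \<open>j\<close>, and then
  in direction \<open>j\<close>.  The left-hand side is symmetric in \<open>i\<close> and \<open>j\<close>, the right-hand side is not: this is
  what makes the mixed derivatives agree.\<close>

lemma second_difference_mean_value:
  assumes "smooth \<phi>" and "0 < h"
  obtains s t where "0 < s" "s < h" "0 < t" "t < h"
    "\<phi> (x + h *\<^sub>R axis i 1 + h *\<^sub>R axis j 1) - \<phi> (x + h *\<^sub>R axis i 1) - \<phi> (x + h *\<^sub>R axis j 1) + \<phi> x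
      = h * h * partial j (partial i \<phi>) (x + s *\<^sub>R axis i 1 + t *\<^sub>R axis j 1)"
proof -
  let ?G = "\<lambda>s. \<phi> (x + h *\<^sub>R axis j 1 + s *\<^sub>R axis i 1) - \<phi> (x + s *\<^sub>R axis i 1)"
  have "\<exists>s. 0 < s \<and> s < h \<and> ?G h - ?G 0 = (h - 0) *
      (partial i \<phi> (x + h *\<^sub>R axis j 1 + s *\<^sub>R axis i 1) - partial i \<phi> (x + s *\<^sub>R axis i 1))"
    by (rule MVT2[OF \<open>0 < h\<close>]) (intro DERIV_diff partial_along_line assms)
  then obtain s where s: "0 < s" "s < h" "?G h - ?G 0 = h *
      (partial i \<phi> (x + h *\<^sub>R axis j 1 + s *\<^sub>R axis i 1) - partial i \<phi> (x + s *\<^sub>R axis i 1))"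
    by auto
  let ?H = "\<lambda>t. partial i \<phi> (x + s *\<^sub>R axis i 1 + t *\<^sub>R axis j 1)"
  have "\<exists>t. 0 < t \<and> t < h \<and> ?H h - ?H 0 = (h - 0) *
      partial j (partial i \<phi>) (x + s *\<^sub>R axis i 1 + t *\<^sub>R axis j 1)"
    by (rule MVT2[OF \<open>0 < h\<close>]) (intro partial_along_line smooth_partial assms)
  then obtain t where t: "0 < t" "t < h" "?H h - ?H 0 = h *
      partial j (partial i \<phi>) (x + s *\<^sub>R axis i 1 + t *\<^sub>R axis j 1)"
    by auto
  show ?thesis
    using that[OF s(1,2) t(1,2)] s(3) t(3) by (simp add: algebra_simps)
qed

text \<open>Both mixed derivatives are the limit of the same second difference divided by \<open>h\<^sup>2\<close>, since the
  intermediate points converge to \<open>x\<close> and the mixed derivatives are continuous.\<close>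

lemma partial_commute:
  assumes "smooth \<phi>"
  shows "partial i (partial j \<phi>) = partial j (partial i \<phi>)"
proof
  fix x
  define e where "e n = inverse (real (Suc n))" for n
  have e0: "0 < e n" for n by (simp add: e_def)
  have elim: "e \<longlonglongrightarrow> 0" unfolding e_def by (rule LIMSEQ_inverse_real_of_nat)
  have lim: "(\<lambda>n. (\<phi> (x + e n *\<^sub>R axis k 1 + e n *\<^sub>R axis l 1) - \<phi> (x + e n *\<^sub>R axis k 1)
      - \<phi> (x + e n *\<^sub>R axis l 1) + \<phi> x) / (e n * e n)) \<longlonglongrightarrow> partial l (partial k \<phi>) x" for k l
  proof -
    have "\<exists>s t. 0 < s \<and> s < e n \<and> 0 < t \<and> t < e n \<and>
      \<phi> (x + e n *\<^sub>R axis k 1 + e n *\<^sub>R axis l 1) - \<phi> (x + e n *\<^sub>R axis k 1)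
        - \<phi> (x + e n *\<^sub>R axis l 1) + \<phi> x
      = e n * e n * partial l (partial k \<phi>) (x + s *\<^sub>R axis k 1 + t *\<^sub>R axis l 1)" for n
      by (rule second_difference_mean_value[OF assms e0]) blast
    then obtain s t where st: "\<And>n. 0 < s n" "\<And>n. s n < e n" "\<And>n. 0 < t n" "\<And>n. t n < e n"
      and eq: "\<And>n. \<phi> (x + e n *\<^sub>R axis k 1 + e n *\<^sub>R axis l 1) - \<phi> (x + e n *\<^sub>R axis k 1)
        - \<phi> (x + e n *\<^sub>R axis l 1) + \<phi> x
      = e n * e n * partial l (partial k \<phi>) (x + s n *\<^sub>R axis k 1 + t n *\<^sub>R axis l 1)"
      by metis
    have "s \<longlonglongrightarrow> 0"
      by (rule tendsto_sandwich[OF _ _ tendsto_const elim]) (auto intro!: always_eventually less_imp_le st)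
    moreover have "t \<longlonglongrightarrow> 0"
      by (rule tendsto_sandwich[OF _ _ tendsto_const elim]) (auto intro!: always_eventually less_imp_le st)
    ultimately have "(\<lambda>n. x + s n *\<^sub>R axis k 1 + t n *\<^sub>R axis l 1) \<longlonglongrightarrow> x + 0 *\<^sub>R axis k 1 + 0 *\<^sub>R axis l 1"
      by (intro tendsto_intros)
    then have "(\<lambda>n. partial l (partial k \<phi>) (x + s n *\<^sub>R axis k 1 + t n *\<^sub>R axis l 1))
        \<longlonglongrightarrow> partial l (partial k \<phi>) x"
      using continuous_on_tendsto_compose[OF smooth_continuous[OF smooth_partial[OF smooth_partial[OF assms]]]]
      by simp
    then show ?thesis
      using e0 by (simp add: eq less_imp_neq[THEN not_sym])
  qed
  have swap: "(\<phi> (x + e n *\<^sub>R axis j 1 + e n *\<^sub>R axis i 1) - \<phi> (x + e n *\<^sub>R axis j 1)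
      - \<phi> (x + e n *\<^sub>R axis i 1) + \<phi> x) / (e n * e n)
    = (\<phi> (x + e n *\<^sub>R axis i 1 + e n *\<^sub>R axis j 1) - \<phi> (x + e n *\<^sub>R axis i 1)
      - \<phi> (x + e n *\<^sub>R axis j 1) + \<phi> x) / (e n * e n)" for n
    by (simp add: ac_simps)
  show "partial i (partial j \<phi>) x = partial j (partial i \<phi>) x"
    using LIMSEQ_unique[OF lim[of j i, unfolded swap] lim[of i j]] .
qed

lemma partial_funpow_commute:
  assumes "smooth \<phi>"
  shows "partial j ((partial i ^^ m) \<phi>) = (partial i ^^ m) (partial j \<phi>)"
  using assms
  by (induction m) (auto simp: partial_commute[OF smooth_partial_funpow])

lemma smooth_foldr_funpow:
  "smooth \<phi> \<Longrightarrow> smooth (foldr (\<lambda>i. partial i ^^ \<alpha> i) is \<phi>)"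
  by (induction "is") (auto intro: smooth_partial_funpow)

lemma partial_foldr_funpow:
  assumes "smooth \<phi>" "distinct is" "j \<in> set is"
  shows "partial j (foldr (\<lambda>i. partial i ^^ \<alpha> i) is \<phi>)
    = foldr (\<lambda>i. partial i ^^ (\<alpha> i + unit_index j i)) is \<phi>"
  using assms(2,3)
proof (induction "is")
  case (Cons i "is")
  show ?case
  proof (cases "i = j")
    case True
    then have "j \<notin> set is" using Cons by auto
    then have "foldr (\<lambda>i. partial i ^^ (\<alpha> i + unit_index j i)) is \<phi> = foldr (\<lambda>i. partial i ^^ \<alpha> i) is \<phi>"
      by (intro foldr_cong[THEN fun_cong] ext) (auto simp: unit_index_def intro!: foldr_cong)
    then show ?thesis by (simp add: True unit_index_def)
  next
    case False
    then show ?thesis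
      using Cons by (simp add: partial_funpow_commute smooth_foldr_funpow assms unit_index_def)
  qed
qed simp

text \<open>Since partial derivatives commute, the additional one can be moved to its place in the ordered list of
  directions by which the iterated derivative is defined.\<close>

lemma partial_partials:
  assumes "smooth \<phi>"
  shows "partial j (partials \<alpha> \<phi>) = partials (\<lambda>i. \<alpha> i + unit_index j i) \<phi>"
  unfolding partials_def by (rule partial_foldr_funpow) (use assms in auto)

lemma partials_zero: "partials (\<lambda>_. 0) \<phi> = \<phi>"
proof -
  have "foldr (\<lambda>j. partial j ^^ 0) is \<phi> = \<phi>" for "is" :: "'a list"
    by (induction "is") auto
  then show ?thesis by (simp add: partials_def)
qed

lemma partials_unit_index: "smooth \<phi> \<Longrightarrow> partials (unit_index j) \<phi> = partial j \<phi>"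
  using partial_partials[of \<phi> j "\<lambda>_. 0"] by (simp add: partials_zero unit_index_def)

lemma partial_eq_0_outside_support:
  assumes "x \<notin> closure {x. \<phi> x \<noteq> 0}"
  shows "partial j \<phi> x = 0"
proof -
  have "((\<lambda>_. 0) has_derivative (\<lambda>_. 0)) (at x)" by simp
  then have "(\<phi> has_derivative (\<lambda>_. 0)) (at x)"
  proof (rule has_derivative_transform_within_open)
    show "open (- closure {x. \<phi> x \<noteq> 0})" by auto
    show "0 = \<phi> y" if "y \<in> - closure {x. \<phi> x \<noteq> 0}" for y
      using that closure_subset[of "{x. \<phi> x \<noteq> 0}"] by fastforce
  qed (use assms in auto)
  then show ?thesis by (simp add: partial_eq)
qed

text \<open>A function vanishes identically near each point outside its closed support, so its derivatives do
  too.\<close>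

lemma test_function_partial:
  assumes "test_function \<Omega> \<phi>"
  shows "test_function \<Omega> (partial j \<phi>)"
proof -
  have "{x. partial j \<phi> x \<noteq> 0} \<subseteq> closure {x. \<phi> x \<noteq> 0}"
    using partial_eq_0_outside_support by blast
  then have sub: "closure {x. partial j \<phi> x \<noteq> 0} \<subseteq> closure {x. \<phi> x \<noteq> 0}"
    by (simp add: closure_minimal)
  have "compact (closure {x. partial j \<phi> x \<noteq> 0})"
    using assms sub bounded_subset unfolding test_function_def compact_eq_bounded_closed by blast
  then show ?thesis
    using assms sub smooth_partial unfolding test_function_def by blast
qed

lemma test_function_partials:
  assumes "test_function \<Omega> \<phi>"
  shows "test_function \<Omega> (partials \<alpha> \<phi>)"
proof -
  have pow: "test_function \<Omega> ((partial j ^^ m) g)" if "test_function \<Omega> g" for j m g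
    using that by (induction m) (auto intro: test_function_partial)
  have "test_function \<Omega> (foldr (\<lambda>j. partial j ^^ \<alpha> j) is \<phi>)" for "is"
    by (induction "is") (auto intro: pow assms)
  then show ?thesis by (simp add: partials_def)
qed


section \<open>Smooth functions supported in a box\<close>

text \<open>For \<open>p = 1\<close> this is the classical smooth function that vanishes to infinite order at \<open>0\<close>.  The
  polynomial factor in \<open>1 / t\<close> makes the family closed under differentiation.\<close>

definition flat :: "real poly \<Rightarrow> real \<Rightarrow> real" where
  "flat p t = (if 0 < t then poly p (1 / t) * exp (- (1 / t)) else 0)"

lemma tendsto_poly_div_exp: "((\<lambda>u. u ^ k * poly p u / exp u) \<longlongrightarrow> (0::real)) at_top"
proof (induction p arbitrary: k)
  case (pCons a p)
  have "((\<lambda>u. a * (u ^ k / exp u) + u ^ Suc k * poly p u / exp u) \<longlongrightarrow> a * 0 + (0::real)) at_top"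
    by (intro tendsto_intros tendsto_power_div_exp_0 pCons.IH)
  then show ?case by (simp add: field_simps)
qed simp

text \<open>For \<open>t > 0\<close> the chain rule turns \<open>p\<close> into \<open>u\<^sup>2 (p - p')\<close> with \<open>u = 1 / t\<close>.  At \<open>t = 0\<close> the right
  difference quotient is \<open>u p(u) exp (- u)\<close> with \<open>u \<rightarrow> \<infinity>\<close>, which tends to \<open>0\<close>.\<close>

lemma flat_has_derivative:
  "(flat p has_real_derivative flat ([:0, 0, 1:] * (p - pderiv p)) t) (at t)"
proof -
  consider "t < 0" | "t = 0" | "0 < t" by linarith
  then show ?thesis
  proof cases
    case 1
    have "((\<lambda>_. 0) has_real_derivative 0) (at t)" by simp
    then have "(flat p has_real_derivative 0) (at t)"
      by (rule has_field_derivative_transform_within_open[of _ _ _ "{..<0}"]) (use 1 in \<open>auto simp: flat_def\<close>)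
    with 1 show ?thesis by (simp add: flat_def)
  next
    case 3
    have r: "((\<lambda>t. 1 / t) has_real_derivative - (1 / t * (1 / t))) (at t)"
      using 3 by (auto intro!: derivative_eq_intros)
    have "((\<lambda>t. poly p (1 / t)) has_real_derivative poly (pderiv p) (1 / t) * (- (1 / t * (1 / t)))) (at t)"
      by (rule DERIV_chain2[OF poly_DERIV r])
    moreover have "((\<lambda>t. exp (- (1 / t))) has_real_derivative exp (- (1 / t)) * (- (- (1 / t * (1 / t))))) (at t)"
      by (rule DERIV_chain2[OF DERIV_exp DERIV_minus[OF r]])
    ultimately have "((\<lambda>t. poly p (1 / t) * exp (- (1 / t))) has_real_derivative
        poly (pderiv p) (1 / t) * (- (1 / t * (1 / t))) * exp (- (1 / t))
        + exp (- (1 / t)) * (- (- (1 / t * (1 / t)))) * poly p (1 / t)) (at t)"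
      by (rule DERIV_mult)
    moreover have "poly (pderiv p) (1 / t) * (- (1 / t * (1 / t))) * exp (- (1 / t))
        + exp (- (1 / t)) * (- (- (1 / t * (1 / t)))) * poly p (1 / t)
      = flat ([:0, 0, 1:] * (p - pderiv p)) t"
      using 3 by (simp add: flat_def algebra_simps)
    ultimately have "((\<lambda>t. poly p (1 / t) * exp (- (1 / t))) has_real_derivative
        flat ([:0, 0, 1:] * (p - pderiv p)) t) (at t)"
      by simp
    then show ?thesis
      by (rule has_field_derivative_transform_within_open[of _ _ _ "{0<..}"]) (use 3 in \<open>auto simp: flat_def\<close>)
  next
    case 2
    have "((\<lambda>h. (1/h) ^ 1 * poly p (1/h) / exp (1/h)) \<longlongrightarrow> 0) (at_right 0)"
      using filterlim_compose[OF tendsto_poly_div_exp[of 1 p] filterlim_inverse_at_top_right]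
      by (simp add: inverse_eq_divide)
    then have "((\<lambda>h. flat p h / h) \<longlongrightarrow> 0) (at_right 0)"
      by (rule Lim_transform_eventually)
        (auto simp: flat_def eventually_at_right_less exp_minus field_simps
          intro!: eventually_mono[OF eventually_at_right_less])
    moreover have "((\<lambda>h. flat p h / h) \<longlongrightarrow> 0) (at_left 0)"
      by (rule tendsto_eventually) (auto simp: flat_def eventually_at_filter)
    ultimately have "((\<lambda>h. flat p h / h) \<longlongrightarrow> 0) (at 0)"
      by (simp add: filterlim_split_at)
    then show ?thesis using 2 by (simp add: DERIV_def flat_def)
  qed
qed

text \<open>Smoothness is a statement about all iterated partial derivatives.  It holds for every member of a
  set of differentiable functions that is closed under partial derivatives, and the algebra generated by
  the functions \<open>flat p\<close> of affine functions of one coordinate is such a set.\<close>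

inductive_set bumps :: "('n::finite euclid \<Rightarrow> real) set" where
  const: "(\<lambda>_. c) \<in> bumps"
| flat: "(\<lambda>x. flat p (a + s * x $ i)) \<in> bumps"
| add: "f \<in> bumps \<Longrightarrow> g \<in> bumps \<Longrightarrow> (\<lambda>x. f x + g x) \<in> bumps"
| mult: "f \<in> bumps \<Longrightarrow> g \<in> bumps \<Longrightarrow> (\<lambda>x. f x * g x) \<in> bumps"

lemma bumps_prod:
  assumes "finite I" "\<And>i. i \<in> I \<Longrightarrow> f i \<in> bumps"
  shows "(\<lambda>x. \<Prod>i\<in>I. f i x) \<in> bumps"
  using assms by (induction I) (auto intro: bumps.const[of 1, simplified] bumps.intros)

lemma bumps_derivative:
  assumes "f \<in> bumps"
  shows "\<exists>f'. (\<forall>x. (f has_derivative f' x) (at x)) \<and> (\<forall>j. (\<lambda>x. f' x (axis j 1)) \<in> bumps)"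
  using assms
proof induction
  case (const c)
  show ?case
    by (rule exI[of _ "\<lambda>_ _. 0"]) (auto intro: bumps.const)
next
  case (flat p a s i)
  let ?q = "[:0, 0, 1:] * (p - pderiv p)"
  have "((\<lambda>x. flat p (a + s * x $ i)) has_derivative (\<lambda>h. flat ?q (a + s * x $ i) * (s * h $ i))) (at x)" for x
  proof -
    have *: "((\<lambda>x. a + s * x $ i) has_derivative (\<lambda>h. s * h $ i)) (at x)"
      by (auto intro!: derivative_eq_intros bounded_linear.has_derivative[OF bounded_linear_vec_nth])
    show ?thesis
      using has_derivative_compose[OF * flat_has_derivative[unfolded has_field_derivative_def]] .
  qed
  moreover have "(\<lambda>x. flat ?q (a + s * x $ i) * (s * axis j 1 $ i)) \<in> bumps" for j
    by (rule bumps.mult[OF bumps.flat bumps.const])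
  ultimately show ?case by (intro exI[of _ "\<lambda>x h. flat ?q (a + s * x $ i) * (s * h $ i)"]) blast
next
  case (add f g)
  then obtain f' g' where "\<And>x. (f has_derivative f' x) (at x)" "\<And>j. (\<lambda>x. f' x (axis j 1)) \<in> bumps"
    "\<And>x. (g has_derivative g' x) (at x)" "\<And>j. (\<lambda>x. g' x (axis j 1)) \<in> bumps"
    by blast
  then show ?case
    by (intro exI[of _ "\<lambda>x h. f' x h + g' x h"]) (auto intro: bumps.add has_derivative_add)
next
  case (mult f g)
  then obtain f' g' where "\<And>x. (f has_derivative f' x) (at x)" "\<And>j. (\<lambda>x. f' x (axis j 1)) \<in> bumps"
    "\<And>x. (g has_derivative g' x) (at x)" "\<And>j. (\<lambda>x. g' x (axis j 1)) \<in> bumps"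
    by blast
  then show ?case
    using mult.hyps
    by (intro exI[of _ "\<lambda>x h. f x * g' x h + f' x h * g x"])
      (auto intro!: bumps.add bumps.mult[of f] bumps.mult[of _ g] has_derivative_mult)
qed

lemma smooth_bumps:
  assumes "f \<in> bumps"
  shows "smooth f"
proof -
  have part: "partial j g \<in> bumps" if g: "g \<in> bumps" for g and j :: 'a
  proof -
    obtain g' where g': "\<And>x. (g has_derivative g' x) (at x)" "\<And>j. (\<lambda>x. g' x (axis j 1)) \<in> bumps"
      using bumps_derivative[OF g] by blast
    have "partial j g = (\<lambda>x. g' x (axis j 1))"
      using partial_eq[OF g'(1)] by auto
    with g' show ?thesis by simp
  qed
  have "foldr partial js f \<in> bumps" for js
    by (induction js) (auto intro: assms part)
  then show ?thesis
    unfolding smooth_def differentiable_on_def differentiable_def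
    using bumps_derivative by blast
qed

text \<open>As \<open>exp (- 1 / (m t)) \<rightarrow> 1\<close> for every \<open>t > 0\<close>, mere dilation by \<open>m\<close> turns a smooth bump into an
  approximation of the indicator of the open box; the supports stay in the closed box.\<close>

definition cutoff :: "'n::finite euclid \<Rightarrow> 'n euclid \<Rightarrow> nat \<Rightarrow> 'n euclid \<Rightarrow> real" where
  "cutoff a b m x = (\<Prod>i\<in>UNIV. flat 1 (real m * (x $ i - a $ i)) * flat 1 (real m * (b $ i - x $ i)))"

lemma smooth_cutoff: "smooth (cutoff a b m)"
proof -
  have "(\<lambda>x. flat 1 (real m * (x $ i - a $ i)) * flat 1 (real m * (b $ i - x $ i))) \<in> bumps" for i
    using bumps.mult[OF bumps.flat[of 1 "- real m * a $ i" "real m" i]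
        bumps.flat[of 1 "real m * b $ i" "- real m" i]]
    by (simp add: algebra_simps)
  then show ?thesis
    unfolding cutoff_def by (intro smooth_bumps bumps_prod) auto
qed

lemma cutoff_outside: "x \<notin> box a b \<Longrightarrow> cutoff a b m x = 0"
  unfolding cutoff_def by (rule prod_zero) (auto simp: mem_box_cart flat_def zero_less_mult_iff)

lemma test_function_cutoff:
  assumes "cbox a b \<subseteq> \<Omega>"
  shows "test_function \<Omega> (cutoff a b m)"
proof -
  have "{x. cutoff a b m x \<noteq> 0} \<subseteq> cbox a b"
    using cutoff_outside box_subset_cbox by blast
  then have sub: "closure {x. cutoff a b m x \<noteq> 0} \<subseteq> cbox a b"
    by (rule closure_minimal) (rule closed_cbox)
  then show ?thesis
    using assms smooth_cutoff bounded_subset[OF bounded_cbox sub]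
    unfolding test_function_def compact_eq_bounded_closed by blast
qed

lemma abs_cutoff_le: "\<bar>cutoff a b m x\<bar> \<le> 1"
proof -
  have "0 \<le> flat 1 t \<and> flat 1 t \<le> 1" for t by (simp add: flat_def)
  then have "0 \<le> cutoff a b m x" "cutoff a b m x \<le> 1"
    unfolding cutoff_def by (auto intro!: prod_nonneg prod_le_1 mult_le_one)
  then show ?thesis by simp
qed

lemma cutoff_tendsto: "(\<lambda>m. cutoff a b m x) \<longlonglongrightarrow> indicator (box a b) x"
proof (cases "x \<in> box a b")
  case True
  have flat1: "(\<lambda>m. flat 1 (real m * c)) \<longlonglongrightarrow> 1" if "0 < c" for c
  proof -
    have "(\<lambda>m. inverse (real m)) \<longlonglongrightarrow> 0" by (rule lim_inverse_n)
    then have "(\<lambda>m. exp (- (inverse (real m) * inverse c))) \<longlonglongrightarrow> exp (- (0 * inverse c))"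
      by (intro tendsto_intros)
    then have "(\<lambda>m. exp (- (inverse (real m) * inverse c))) \<longlonglongrightarrow> 1" by simp
    then show ?thesis
      by (rule Lim_transform_eventually)
        (use that in \<open>auto simp: flat_def divide_inverse intro!: eventually_mono[OF eventually_gt_at_top[of 0]]\<close>)
  qed
  have "(\<lambda>m. cutoff a b m x) \<longlonglongrightarrow> (\<Prod>i\<in>(UNIV::'a set). 1 * 1)"
    unfolding cutoff_def
    by (intro tendsto_prod tendsto_mult flat1) (use True in \<open>auto simp: mem_box_cart\<close>)
  with True show ?thesis by simp
qed (simp add: cutoff_outside)


section \<open>The fundamental lemma of the calculus of variations\<close>

text \<open>Boxes form an intersection-stable generator of the Borel sets, so all Borel integrals vanish by
  Dynkin's argument.  That argument is run for a Borel representative \<open>g\<close> of \<open>f\<close>, since Lebesgue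
  measurable sets are generated by boxes only up to null sets.\<close>

lemma integrable_zero_of_box_integrals:
  fixes f :: "'a::euclidean_space \<Rightarrow> real"
  assumes f: "integrable lebesgue f"
    and box: "\<And>c d. (LINT x:box c d|lebesgue. f x) = 0"
  shows "AE x in lebesgue. f x = 0"
proof -
  have fm: "f \<in> borel_measurable lebesgue" using f by simp
  obtain g where g[measurable]: "g \<in> borel_measurable lborel" and fg: "AE x in lborel. f x = g x"
    using completion_ex_borel_measurable_real[OF fm] by blast
  have fg': "AE x in lebesgue. f x = g x"
    using fg by (rule AE_completion)
  have gl: "g \<in> borel_measurable lebesgue"
    using g by (rule measurable_completion)
  have "integrable lebesgue g"
    using f fg' gl fm integrable_cong_AE by blast
  then have ig: "integrable lborel g"
    by (simp add: integrable_completion)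
  have P: "set_lebesgue_integral lborel A g = 0" if "A \<in> sets lborel" for A
  proof -
    let ?G = "range (\<lambda>(a, b). box a b :: 'a set)"
    have si: "set_integrable lborel B g" if "B \<in> sets borel" for B
      using ig that unfolding set_integrable_def by (intro integrable_mult_indicator) auto
    have boxg: "set_lebesgue_integral lborel (box c d) g = 0" for c d
    proof -
      have "set_lebesgue_integral lborel (box c d) g = set_lebesgue_integral lebesgue (box c d) g"
        unfolding set_lebesgue_integral_def by (rule integral_completion[symmetric]) simp
      also have "\<dots> = (LINT x:box c d|lebesgue. f x)"
        unfolding set_lebesgue_integral_def
      proof (rule integral_cong_AE)
        show "AE x in lebesgue. indicator (box c d) x *\<^sub>R g x = indicator (box c d) x *\<^sub>R f x"
          using fg' by eventually_elim simp
      qed (intro borel_measurable_scaleR borel_measurable_indicator fm gl, simp)+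
      finally show ?thesis using box by simp
    qed
    \<comment> \<open>The complement step needs the total integral: the boxes exhaust the space.\<close>
    have U: "set_lebesgue_integral lborel UNIV g = 0"
    proof -
      let ?B = "\<lambda>n. box (- (real n *\<^sub>R One)) (real n *\<^sub>R One) :: 'a set"
      have UN: "(\<Union>n. ?B n) = UNIV" by (rule UN_box_eq_UNIV)
      have inc: "incseq ?B"
        by (auto simp: incseq_def mem_box inner_sum_left inner_Basis intro!: monoI)
          (smt (verit) of_nat_mono)+
      have "(\<lambda>n. set_lebesgue_integral lborel (?B n) g) \<longlonglongrightarrow> set_lebesgue_integral lborel (\<Union>n. ?B n) g"
        by (rule set_integral_cont_up[OF _ inc]) (use si UN in auto)
      then have "(\<lambda>n. 0) \<longlonglongrightarrow> set_lebesgue_integral lborel UNIV g"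
        by (simp only: boxg UN)
      then show ?thesis using LIMSEQ_unique tendsto_const by blast
    qed
    have "Int_stable ?G"
      by (auto simp: Int_stable_def box_Int_box)
    moreover have "?G \<subseteq> Pow UNIV" by simp
    moreover have "A \<in> sigma_sets UNIV ?G"
      using that by (simp add: borel_eq_box)
    ultimately show ?thesis
    proof (induction rule: sigma_sets_induct_disjoint)
      case (basic A)
      then show ?case using boxg by auto
    next
      case empty
      show ?case by (simp add: set_lebesgue_integral_def)
    next
      case (compl A)
      then have A: "A \<in> sets borel" by (simp add: borel_eq_box)
      have "set_lebesgue_integral lborel (A \<union> (UNIV - A)) g
          = set_lebesgue_integral lborel A g + set_lebesgue_integral lborel (UNIV - A) g"
        by (rule set_integral_Un) (use A si in auto)
      then show ?case using U compl by simp
    next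
      case (union A)
      then have A: "A i \<in> sets borel" for i by (auto simp: borel_eq_box)
      have "set_lebesgue_integral lborel (\<Union>i. A i) g = (\<Sum>i. set_lebesgue_integral lborel (A i) g)"
        by (rule lebesgue_integral_countable_add)
          (use A si union.hyps(1) in \<open>auto simp: disjoint_family_on_def\<close>)
      then show ?case using union by simp
    qed
  qed
  have "AE x in lborel. g x = 0"
    by (rule sigma_finite_measure.density_zero[OF sigma_finite_lborel ig P])
  then have "AE x in lborel. f x = 0" using fg by eventually_elim simp
  then show ?thesis by (rule AE_completion)
qed

text \<open>Dominated convergence along \<open>cutoff\<close> shows that \<open>v\<close> has integral zero over each box whose closure
  lies in \<open>\<Omega>\<close>, hence vanishes almost everywhere on such a box; countably many of them cover \<open>\<Omega>\<close> up to a
  null set.\<close>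

lemma fundamental_lemma_calculus_of_variations:
  fixes v :: "'n::finite euclid \<Rightarrow> real"
  assumes "open \<Omega>" and v: "locally_integrable \<Omega> v"
    and zero: "\<And>\<phi>. test_function \<Omega> \<phi> \<Longrightarrow> (LINT x:\<Omega>|lebesgue. v x * \<phi> x) = 0"
  shows "AE x in lebesgue. x \<in> \<Omega> \<longrightarrow> v x = 0"
proof -
  have box: "(LINT x:box a b|lebesgue. v x) = 0" if ab: "cbox a b \<subseteq> \<Omega>" for a b
  proof -
    have int: "integrable lebesgue (\<lambda>x. indicator (cbox a b) x *\<^sub>R v x)"
      using v ab unfolding locally_integrable_def set_integrable_def by auto
    have eq: "indicator \<Omega> x *\<^sub>R (v x * cutoff a b m x) = (indicator (cbox a b) x *\<^sub>R v x) * cutoff a b m x" for m x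
      using ab box_subset_cbox[of a b] cutoff_outside[of x a b m] by (auto simp: indicator_def)
    have "(\<lambda>m. LINT x|lebesgue. (indicator (cbox a b) x *\<^sub>R v x) * cutoff a b m x)
        \<longlonglongrightarrow> (LINT x|lebesgue. (indicator (cbox a b) x *\<^sub>R v x) * indicator (box a b) x)"
    proof (rule integral_dominated_convergence)
      show "integrable lebesgue (\<lambda>x. \<bar>indicator (cbox a b) x *\<^sub>R v x\<bar>)"
        using int by (rule integrable_abs)
      show "(\<lambda>x. (indicator (cbox a b) x *\<^sub>R v x) * indicator (box a b) x) \<in> borel_measurable lebesgue"
        using int by (intro borel_measurable_times borel_measurable_indicator) auto
      have "cutoff a b m \<in> borel_measurable lebesgue" for m
        by (intro measurable_completion) (simp add: borel_measurable_continuous_onI smooth_continuous smooth_cutoff)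
      then show "(\<lambda>x. (indicator (cbox a b) x *\<^sub>R v x) * cutoff a b m x) \<in> borel_measurable lebesgue" for m
        using int by (intro borel_measurable_times) auto
      show "AE x in lebesgue. (\<lambda>m. (indicator (cbox a b) x *\<^sub>R v x) * cutoff a b m x)
          \<longlonglongrightarrow> (indicator (cbox a b) x *\<^sub>R v x) * indicator (box a b) x"
        by (intro AE_I2 tendsto_intros cutoff_tendsto)
      show "AE x in lebesgue. norm ((indicator (cbox a b) x *\<^sub>R v x) * cutoff a b m x)
          \<le> \<bar>indicator (cbox a b) x *\<^sub>R v x\<bar>" for m
        by (intro AE_I2) (simp add: abs_mult mult_left_le abs_cutoff_le)
    qed
    moreover have "(LINT x|lebesgue. (indicator (cbox a b) x *\<^sub>R v x) * cutoff a b m x) = 0" for m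
      using zero[OF test_function_cutoff[OF ab], of m] by (simp only: set_lebesgue_integral_def eq)
    ultimately have "(\<lambda>m. 0) \<longlonglongrightarrow> (LINT x|lebesgue. (indicator (cbox a b) x *\<^sub>R v x) * indicator (box a b) x)"
      by (simp only:)
    then have "(LINT x|lebesgue. (indicator (cbox a b) x *\<^sub>R v x) * indicator (box a b) x) = 0"
      by (rule LIMSEQ_unique) (rule tendsto_const)
    moreover have "(indicator (cbox a b) x *\<^sub>R v x) * indicator (box a b) x = indicator (box a b) x *\<^sub>R v x" for x
      using box_subset_cbox[of a b] by (auto simp: indicator_def)
    ultimately show ?thesis by (simp only: set_lebesgue_integral_def)
  qed
  have cbox: "AE x in lebesgue. x \<in> cbox a b \<longrightarrow> v x = 0" if ab: "cbox a b \<subseteq> \<Omega>" for a b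
  proof -
    have "AE x in lebesgue. indicator (box a b) x *\<^sub>R v x = 0"
    proof (rule integrable_zero_of_box_integrals)
      have "set_integrable lebesgue (cbox a b) v"
        using v ab unfolding locally_integrable_def by auto
      then have "set_integrable lebesgue (box a b) v"
        by (rule set_integrable_subset) (auto simp: box_subset_cbox)
      then show "integrable lebesgue (\<lambda>x. indicator (box a b) x *\<^sub>R v x)"
        by (simp add: set_integrable_def)
      show "(LINT x:box c d|lebesgue. indicator (box a b) x *\<^sub>R v x) = 0" for c d
      proof -
        obtain c' d' where cd: "box a b \<inter> box c d = box c' d'"
          using box_Int_box[of a b c d] by blast
        have "(LINT x:box c d|lebesgue. indicator (box a b) x *\<^sub>R v x) = (LINT x:box c' d'|lebesgue. v x)"
          unfolding set_lebesgue_integral_def cd[symmetric]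
          by (rule Bochner_Integration.integral_cong) (auto simp: indicator_def)
        \<comment> \<open>A nonempty intersection has its closure inside \<open>cbox a b\<close>, so the integral over it
          vanishes by the first step.  The corners of an empty box are unconstrained, hence the case distinction.\<close>
        also have "\<dots> = 0"
        proof (cases "box c' d' = {}")
          case True
          then show ?thesis by (simp add: set_lebesgue_integral_def)
        next
          case False
          then have "box a b \<noteq> {}" using cd by auto
          then have "cbox c' d' \<subseteq> cbox a b"
            using cd False closure_mono[of "box c' d'" "box a b"] by auto
          then show ?thesis using ab by (intro box) auto
        qed
        finally show ?thesis .
      qed
    qed
    moreover have "AE x in lebesgue. x \<notin> cbox a b - box a b"
      using AE_not_in[OF null_sets_cbox_Diff_box] by (rule AE_completion)
    ultimately show ?thesis
      by eventually_elim (auto simp: indicator_def split: if_splits)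
  qed
  obtain \<D> where D: "countable \<D>" "\<D> \<subseteq> Pow \<Omega>" "\<And>X. X \<in> \<D> \<Longrightarrow> \<exists>a b. X = cbox a b" "\<Union>\<D> = \<Omega>"
    using open_countable_Union_open_cbox[OF \<open>open \<Omega>\<close>] by blast
  have "AE x in lebesgue. \<forall>X\<in>\<D>. x \<in> X \<longrightarrow> v x = 0"
    unfolding AE_ball_countable[OF D(1)]
  proof
    fix X assume X: "X \<in> \<D>"
    then obtain a b where "X = cbox a b" using D by blast
    then show "AE x in lebesgue. x \<in> X \<longrightarrow> v x = 0" using cbox[of a b] D(2) X by auto
  qed
  then show ?thesis by eventually_elim (use D(4) in auto)
qed


section \<open>Weak derivatives\<close>

lemma set_integral_sum:
  fixes f :: "'i \<Rightarrow> 'a \<Rightarrow> 'b::{banach,second_countable_topology}"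
  assumes "\<And>i. i \<in> I \<Longrightarrow> set_integrable M A (f i)"
  shows "set_integrable M A (\<lambda>x. \<Sum>i\<in>I. f i x)"
    and "(LINT x:A|M. \<Sum>i\<in>I. f i x) = (\<Sum>i\<in>I. LINT x:A|M. f i x)"
  using assms unfolding set_integrable_def set_lebesgue_integral_def scaleR_sum_right by simp_all

lemma locally_integrable_sum:
  "(\<And>i. i \<in> I \<Longrightarrow> locally_integrable \<Omega> (u i)) \<Longrightarrow> locally_integrable \<Omega> (\<lambda>x. \<Sum>i\<in>I. u i x)"
  unfolding locally_integrable_def by (auto intro!: set_integral_sum)

lemma locally_integrable_bounded_linear:
  assumes "bounded_linear T" "locally_integrable \<Omega> u"
  shows "locally_integrable \<Omega> (\<lambda>x. T (u x))"
proof -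
  have "set_integrable lebesgue K (\<lambda>x. T (u x))" if "set_integrable lebesgue K u" for K
    using integrable_bounded_linear[OF assms(1) that[unfolded set_integrable_def]]
    by (simp add: set_integrable_def linear_scale[OF bounded_linear.linear[OF assms(1)]])
  with assms(2) show ?thesis unfolding locally_integrable_def by blast
qed

lemma locally_integrable_cmult:
  "locally_integrable \<Omega> u \<Longrightarrow> locally_integrable \<Omega> (\<lambda>x. c * u x :: real)"
  by (rule locally_integrable_bounded_linear[OF bounded_linear_mult_right])

lemma test_function_continuous: "test_function \<Omega> \<phi> \<Longrightarrow> continuous_on UNIV \<phi>"
  by (simp add: test_function_def smooth_continuous)

text \<open>On the compact support of \<open>\<phi>\<close> the function \<open>v\<close> is integrable and \<open>\<phi>\<close> is bounded.  This makes
  the pairing of \<open>v\<close> with test functions additive in \<open>v\<close>.\<close>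

lemma locally_integrable_test_function:
  fixes v :: "'n::finite euclid \<Rightarrow> real"
  assumes v: "locally_integrable \<Omega> v" and \<phi>: "test_function \<Omega> \<phi>"
  shows "set_integrable lebesgue \<Omega> (\<lambda>x. v x * \<phi> x)"
proof -
  define K where "K = closure {x. \<phi> x \<noteq> 0}"
  have K: "compact K" "K \<subseteq> \<Omega>" using \<phi> by (auto simp: test_function_def K_def)
  have "compact (\<phi> ` K)"
    using K test_function_continuous[OF \<phi>] by (blast intro: compact_continuous_image continuous_on_subset)
  then have "\<exists>B. \<forall>x\<in>K. \<bar>\<phi> x\<bar> \<le> B"
    by (auto dest!: compact_imp_bounded simp: bounded_iff)
  then obtain B where B: "\<And>x. x \<in> K \<Longrightarrow> \<bar>\<phi> x\<bar> \<le> B"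
    by blast
  have int: "integrable lebesgue (\<lambda>x. indicator K x *\<^sub>R v x)"
    using v K unfolding locally_integrable_def set_integrable_def by auto
  have \<phi>m: "\<phi> \<in> borel_measurable lebesgue"
    by (intro measurable_completion) (simp add: borel_measurable_continuous_onI test_function_continuous[OF \<phi>])
  have "integrable lebesgue (\<lambda>x. (indicator K x *\<^sub>R v x) * \<phi> x)"
  proof (rule Bochner_Integration.integrable_bound)
    show "integrable lebesgue (\<lambda>x. B * (indicator K x *\<^sub>R v x))" using int by simp
    show "(\<lambda>x. (indicator K x *\<^sub>R v x) * \<phi> x) \<in> borel_measurable lebesgue"
      using int \<phi>m by (intro borel_measurable_times) auto
    show "AE x in lebesgue. norm ((indicator K x *\<^sub>R v x) * \<phi> x) \<le> norm (B * (indicator K x *\<^sub>R v x))"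
    proof (intro AE_I2)
      fix x
      show "norm ((indicator K x *\<^sub>R v x) * \<phi> x) \<le> norm (B * (indicator K x *\<^sub>R v x))"
      proof (cases "x \<in> K")
        case True
        then have "\<bar>\<phi> x\<bar> \<le> \<bar>B\<bar>" using B by fastforce
        then show ?thesis using True by (simp add: abs_mult mult.commute[of "\<bar>v x\<bar>"] mult_right_mono)
      qed simp
    qed
  qed
  moreover have "(indicator K x *\<^sub>R v x) * \<phi> x = indicator \<Omega> x *\<^sub>R (v x * \<phi> x)" for x
    using K(2) closure_subset[of "{x. \<phi> x \<noteq> 0}"] by (auto simp: indicator_def K_def)
  ultimately show ?thesis by (simp only: set_integrable_def)
qed

text \<open>The difference of the two weak derivatives is orthogonal to all test functions.\<close>

lemma has_weak_deriv_unique: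
  fixes \<Omega> :: "'n::{finite,linorder} euclid set"
  assumes "open \<Omega>" "has_weak_deriv \<Omega> \<alpha> u v" "has_weak_deriv \<Omega> \<alpha> u w"
  shows "AE x in lebesgue. x \<in> \<Omega> \<longrightarrow> v x = w x"
proof -
  have v: "locally_integrable \<Omega> v" and w: "locally_integrable \<Omega> w"
    using assms(2,3) by (auto simp: has_weak_deriv_def)
  have "AE x in lebesgue. x \<in> \<Omega> \<longrightarrow> v x - w x = 0"
  proof (rule fundamental_lemma_calculus_of_variations[OF \<open>open \<Omega>\<close>])
    show "locally_integrable \<Omega> (\<lambda>x. v x - w x)"
      using v w unfolding locally_integrable_def by (auto intro: set_integral_diff)
    fix \<phi> assume \<phi>: "test_function \<Omega> \<phi>"
    have "(- 1) ^ order_of \<alpha> * (LINT x:\<Omega>|lebesgue. v x * \<phi> x)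
        = (- 1) ^ order_of \<alpha> * (LINT x:\<Omega>|lebesgue. w x * \<phi> x)"
      using assms(2,3) \<phi> unfolding has_weak_deriv_def by (auto dest!: spec[of _ \<phi>])
    then have "(LINT x:\<Omega>|lebesgue. v x * \<phi> x) = (LINT x:\<Omega>|lebesgue. w x * \<phi> x)"
      by simp
    then show "(LINT x:\<Omega>|lebesgue. (v x - w x) * \<phi> x) = 0"
      using set_integral_diff(2)[OF locally_integrable_test_function[OF v \<phi>] locally_integrable_test_function[OF w \<phi>]]
      by (simp add: left_diff_distrib)
  qed
  then show ?thesis by eventually_elim simp
qed

lemma has_weak_deriv_weak_deriv:
  "has_weak_deriv \<Omega> \<alpha> u v \<Longrightarrow> has_weak_deriv \<Omega> \<alpha> u (weak_deriv \<Omega> \<alpha> u)"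
  unfolding weak_deriv_def by (rule someI[of "has_weak_deriv \<Omega> \<alpha> u"])

lemma has_weak_deriv_cmult:
  assumes "has_weak_deriv \<Omega> \<alpha> u v"
  shows "has_weak_deriv \<Omega> \<alpha> (\<lambda>x. c * u x) (\<lambda>x. c * v x)"
proof -
  have "(LINT x:\<Omega>|lebesgue. c * u x * partials \<alpha> \<phi> x) = (- 1) ^ order_of \<alpha> * (LINT x:\<Omega>|lebesgue. c * v x * \<phi> x)"
    if "test_function \<Omega> \<phi>" for \<phi>
  proof -
    have "(LINT x:\<Omega>|lebesgue. u x * partials \<alpha> \<phi> x) = (- 1) ^ order_of \<alpha> * (LINT x:\<Omega>|lebesgue. v x * \<phi> x)"
      using assms that unfolding has_weak_deriv_def by blast
    then show ?thesis by (simp add: mult.assoc)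
  qed
  then show ?thesis
    using assms unfolding has_weak_deriv_def by (blast intro: locally_integrable_cmult)
qed

lemma has_weak_deriv_sum:
  fixes u v :: "'i \<Rightarrow> 'n::{finite,linorder} euclid \<Rightarrow> real"
  assumes uv: "\<And>i. i \<in> I \<Longrightarrow> has_weak_deriv \<Omega> \<alpha> (u i) (v i)"
  shows "has_weak_deriv \<Omega> \<alpha> (\<lambda>x. \<Sum>i\<in>I. u i x) (\<lambda>x. \<Sum>i\<in>I. v i x)"
proof -
  have u: "locally_integrable \<Omega> (u i)" and v: "locally_integrable \<Omega> (v i)" if "i \<in> I" for i
    using uv[OF that] by (auto simp: has_weak_deriv_def)
  have pair: "(LINT x:\<Omega>|lebesgue. (\<Sum>i\<in>I. u i x) * partials \<alpha> \<phi> x)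
      = (- 1) ^ order_of \<alpha> * (LINT x:\<Omega>|lebesgue. (\<Sum>i\<in>I. v i x) * \<phi> x)"
    if \<phi>: "test_function \<Omega> \<phi>" for \<phi>
  proof -
    have "(LINT x:\<Omega>|lebesgue. (\<Sum>i\<in>I. u i x) * partials \<alpha> \<phi> x)
        = (\<Sum>i\<in>I. LINT x:\<Omega>|lebesgue. u i x * partials \<alpha> \<phi> x)"
      unfolding sum_distrib_right
      by (intro set_integral_sum(2) locally_integrable_test_function test_function_partials u \<phi>)
    also have "\<dots> = (\<Sum>i\<in>I. (- 1) ^ order_of \<alpha> * (LINT x:\<Omega>|lebesgue. v i x * \<phi> x))"
      by (rule sum.cong[OF refl]) (use uv \<phi> in \<open>unfold has_weak_deriv_def, blast\<close>)
    also have "\<dots> = (- 1) ^ order_of \<alpha> * (LINT x:\<Omega>|lebesgue. (\<Sum>i\<in>I. v i x) * \<phi> x)"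
    proof -
      have "(LINT x:\<Omega>|lebesgue. (\<Sum>i\<in>I. v i x) * \<phi> x) = (\<Sum>i\<in>I. LINT x:\<Omega>|lebesgue. v i x * \<phi> x)"
        unfolding sum_distrib_right
        by (intro set_integral_sum(2) locally_integrable_test_function v \<phi>)
      then show ?thesis by (simp only: sum_distrib_left)
    qed
    finally show ?thesis .
  qed
  have "locally_integrable \<Omega> (\<lambda>x. \<Sum>i\<in>I. u i x)" "locally_integrable \<Omega> (\<lambda>x. \<Sum>i\<in>I. v i x)"
    by (intro locally_integrable_sum u v; assumption)+
  then show ?thesis
    using pair unfolding has_weak_deriv_def by blast
qed

lemma order_of_add_unit: "order_of (\<lambda>i. \<alpha> i + unit_index j i) = Suc (order_of \<alpha>)"
  by (simp add: sum.distrib unit_index_def)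

text \<open>Test \<open>w = \<partial>\<^sub>j u\<close> against \<open>\<partial>\<^sup>\<alpha> \<phi>\<close>, which is again a test function, and move \<open>\<partial>\<^sub>j\<close> to the other side:
  this gives \<open>- \<integral> u \<partial>\<^sub>j \<partial>\<^sup>\<alpha> \<phi>\<close>, which the derivative of order \<open>\<alpha> + j\<close> of \<open>u\<close> evaluates.\<close>

lemma has_weak_deriv_first_order_then:
  assumes w: "has_weak_deriv \<Omega> (unit_index j) u w"
    and v: "has_weak_deriv \<Omega> (\<lambda>i. \<alpha> i + unit_index j i) u v"
  shows "has_weak_deriv \<Omega> \<alpha> w v"
  unfolding has_weak_deriv_def
proof (intro conjI allI impI)
  show "locally_integrable \<Omega> w" "locally_integrable \<Omega> v"
    using w v by (auto simp: has_weak_deriv_def)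
  fix \<phi> assume \<phi>: "test_function \<Omega> \<phi>"
  then have sm: "smooth \<phi>" and sm': "smooth (partials \<alpha> \<phi>)"
    using test_function_partials[OF \<phi>] by (auto simp: test_function_def)
  have "order_of (unit_index j) = 1" by (simp add: unit_index_def)
  then have "(LINT x:\<Omega>|lebesgue. u x * partial j (partials \<alpha> \<phi>) x)
      = - (LINT x:\<Omega>|lebesgue. w x * partials \<alpha> \<phi> x)"
    using w test_function_partials[OF \<phi>] by (simp add: has_weak_deriv_def partials_unit_index[OF sm', symmetric])
  moreover have "(LINT x:\<Omega>|lebesgue. u x * partial j (partials \<alpha> \<phi>) x)
      = (- 1) ^ Suc (order_of \<alpha>) * (LINT x:\<Omega>|lebesgue. v x * \<phi> x)"
    using v \<phi> unfolding has_weak_deriv_def order_of_add_unit partial_partials[OF sm] by blast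
  ultimately show "(LINT x:\<Omega>|lebesgue. w x * partials \<alpha> \<phi> x)
      = (- 1) ^ order_of \<alpha> * (LINT x:\<Omega>|lebesgue. v x * \<phi> x)"
    by simp
qed


section \<open>Modulars and convexity\<close>

text \<open>Over an infinite index set the sum in the definition of the modular would be \<open>0\<close>, and enlarging the
  order could decrease it.\<close>

lemma finite_multi_indices: "finite {\<alpha> :: 'n::finite multi_index. order_of \<alpha> \<le> k}"
proof -
  have "{\<alpha> :: 'n multi_index. order_of \<alpha> \<le> k} \<subseteq> PiE UNIV (\<lambda>_. {..k})"
  proof
    fix \<alpha> :: "'n multi_index" assume "\<alpha> \<in> {\<alpha>. order_of \<alpha> \<le> k}"
    then have "\<alpha> j \<le> k" for j
      using member_le_sum[of j UNIV \<alpha>] by simp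
    then show "\<alpha> \<in> PiE UNIV (\<lambda>_. {..k})" by auto
  qed
  then show ?thesis by (rule finite_subset) (simp add: finite_PiE)
qed

text \<open>Local integrability yields measurability on compact sets only; \<open>\<Omega>\<close> is exhausted by a sequence of
  them.\<close>

lemma locally_integrable_measurable:
  fixes v :: "'n::finite euclid \<Rightarrow> real"
  assumes "open \<Omega>" "locally_integrable \<Omega> v"
  shows "(\<lambda>x. indicator \<Omega> x * v x) \<in> borel_measurable lebesgue"
proof -
  obtain C where C: "\<And>n. compact (C n)" "\<And>n. C n \<subseteq> \<Omega>" "\<And>n. C n \<subseteq> C (Suc n)" "\<Union> (range C) = \<Omega>"
  proof (rule open_Union_compact_subsets[OF \<open>open \<Omega>\<close>])
    fix C assume "\<And>n. compact (C n)" "\<And>n. C n \<subseteq> \<Omega>" "\<And>n. C n \<subseteq> interior (C (Suc n))" "\<Union> (range C) = \<Omega>"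
    then show thesis
      using that[of C] interior_subset by blast
  qed
  have mono: "C m \<subseteq> C n" if "m \<le> n" for m n
    using C(3) that by (rule lift_Suc_mono_le)
  show ?thesis
  proof (rule borel_measurable_LIMSEQ_real)
    show "(\<lambda>x. indicator (C n) x *\<^sub>R v x) \<in> borel_measurable lebesgue" for n
      using assms(2) C(1,2) unfolding locally_integrable_def set_integrable_def by blast
    show "(\<lambda>n. indicator (C n) x *\<^sub>R v x) \<longlonglongrightarrow> indicator \<Omega> x * v x" for x
    proof (cases "x \<in> \<Omega>")
      case True
      then obtain m where "x \<in> C m" using C(4) by auto
      then have "indicator (C n) x *\<^sub>R v x = indicator \<Omega> x * v x" if "m \<le> n" for n
        using mono[OF that] True by auto
      then show ?thesis
        by (intro tendsto_eventually eventually_sequentiallyI[of m])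
    next
      case False
      then have "indicator (C n) x *\<^sub>R v x = indicator \<Omega> x * v x" for n
        using C(2)[of n] False by (auto simp: indicator_def)
      then show ?thesis by (simp only: tendsto_const)
    qed
  qed
qed

text \<open>The contribution to the modular of one weak derivative, for any representative \<open>v\<close> of it.\<close>

definition integral_modular :: "'n::finite euclid set \<Rightarrow> (real \<Rightarrow> real) \<Rightarrow> ('n euclid \<Rightarrow> real) \<Rightarrow> real \<Rightarrow> ennreal" where
  "integral_modular \<Omega> \<psi> v \<beta> = (\<integral>\<^sup>+x\<in>\<Omega>. ennreal (\<psi> (\<bar>v x\<bar> / \<beta>)) \<partial>lebesgue)"

text \<open>The representative chosen by \<open>weak_deriv\<close> is inaccessible; uniqueness almost everywhere lets the modular
  be computed from derivatives that are at hand.\<close>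

lemma modular_eq:
  assumes "open \<Omega>" and v: "\<And>\<alpha>. order_of \<alpha> \<le> k \<Longrightarrow> has_weak_deriv \<Omega> \<alpha> u (v \<alpha>)"
  shows "modular \<Omega> \<psi> k u \<beta> = (\<Sum>\<alpha> | order_of \<alpha> \<le> k. integral_modular \<Omega> \<psi> (v \<alpha>) \<beta>)"
  unfolding modular_def integral_modular_def
proof (rule sum.cong[OF refl])
  fix \<alpha> :: "'a multi_index" assume "\<alpha> \<in> {\<alpha>. order_of \<alpha> \<le> k}"
  then have \<alpha>: "has_weak_deriv \<Omega> \<alpha> u (v \<alpha>)" using v by simp
  have "AE x in lebesgue. x \<in> \<Omega> \<longrightarrow> weak_deriv \<Omega> \<alpha> u x = v \<alpha> x"
    by (rule has_weak_deriv_unique[OF \<open>open \<Omega>\<close> has_weak_deriv_weak_deriv[OF \<alpha>] \<alpha>])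
  then show "(\<integral>\<^sup>+x\<in>\<Omega>. ennreal (\<psi> (\<bar>weak_deriv \<Omega> \<alpha> u x\<bar> / \<beta>)) \<partial>lebesgue)
      = (\<integral>\<^sup>+x\<in>\<Omega>. ennreal (\<psi> (\<bar>v \<alpha> x\<bar> / \<beta>)) \<partial>lebesgue)"
    by (intro nn_integral_cong_AE) (auto elim!: eventually_mono simp: indicator_def)
qed

lemma orlicz_nonneg: "orlicz \<psi> \<Longrightarrow> 0 \<le> x \<Longrightarrow> 0 \<le> \<psi> x"
  by (simp add: orlicz_def)

lemma orlicz_mono: "orlicz \<psi> \<Longrightarrow> 0 \<le> x \<Longrightarrow> x \<le> y \<Longrightarrow> \<psi> x \<le> \<psi> y"
  unfolding orlicz_def mono_on_def by auto

text \<open>\<open>\<psi>\<close> is known to be monotone, hence Borel measurable, only on \<open>[0, \<infinity>)\<close>; the proof extends it by the constant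
  \<open>\<psi> 0\<close>.\<close>

lemma integrand_measurable:
  assumes "open \<Omega>" "orlicz \<psi>" "locally_integrable \<Omega> v" "0 < \<beta>"
  shows "(\<lambda>x. ennreal (\<psi> (\<bar>v x\<bar> / \<beta>)) * indicator \<Omega> x) \<in> borel_measurable lebesgue"
proof -
  have "mono (\<lambda>t. \<psi> (max 0 t))"
    by (rule monoI, rule orlicz_mono[OF assms(2)]) auto
  then have \<psi>m: "(\<lambda>t. \<psi> (max 0 t)) \<in> borel_measurable borel"
    by (rule borel_measurable_mono)
  have "(\<lambda>x. (\<lambda>t. \<psi> (max 0 t)) (\<bar>indicator \<Omega> x * v x\<bar> / \<beta>)) \<in> borel_measurable lebesgue"
    by (rule measurable_compose[OF _ \<psi>m], rule borel_measurable_divide, rule borel_measurable_abs)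
      (auto intro: locally_integrable_measurable[OF assms(1,3)])
  then have "(\<lambda>x. ennreal ((\<lambda>t. \<psi> (max 0 t)) (\<bar>indicator \<Omega> x * v x\<bar> / \<beta>)) * indicator \<Omega> x) \<in> borel_measurable lebesgue"
    using assms(1) by (intro borel_measurable_times_ennreal borel_measurable_indicator measurable_compose[OF _ measurable_ennreal]) auto
  moreover have "ennreal ((\<lambda>t. \<psi> (max 0 t)) (\<bar>indicator \<Omega> x * v x\<bar> / \<beta>)) * indicator \<Omega> x
      = ennreal (\<psi> (\<bar>v x\<bar> / \<beta>)) * indicator \<Omega> x" for x
    using assms(4) by (simp add: indicator_def)
  ultimately show ?thesis by simp
qed

text \<open>With \<open>\<beta> = \<Sum>\<^sub>j \<beta>\<^sub>j\<close>, the number \<open>(\<Sum>\<^sub>j \<bar>y\<^sub>j\<bar>) / \<beta>\<close> is the convex combination of the \<open>\<bar>y\<^sub>j\<bar> / \<beta>\<^sub>j\<close> with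
  weights \<open>\<beta>\<^sub>j / \<beta>\<close>, and \<open>\<psi>\<close> is monotone and convex.\<close>

lemma orlicz_convex_combination:
  assumes \<psi>: "orlicz \<psi>" and "finite J" "J \<noteq> {}" and \<beta>: "\<And>j. j \<in> J \<Longrightarrow> 0 < \<beta> j"
    and s: "\<And>j. j \<in> J \<Longrightarrow> \<bar>s j\<bar> = 1"
  shows "\<psi> (\<bar>\<Sum>j\<in>J. s j * y j\<bar> / sum \<beta> J) \<le> (\<Sum>j\<in>J. (\<beta> j / sum \<beta> J) * \<psi> (\<bar>y j\<bar> / \<beta> j))"
proof -
  have S: "0 < sum \<beta> J" using assms by (intro sum_pos) auto
  have weight: "0 \<le> \<beta> j / sum \<beta> J" and scaled: "0 \<le> \<bar>y j\<bar> / \<beta> j" if "j \<in> J" for j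
    using S \<beta>[OF that] by simp_all
  have "\<bar>\<Sum>j\<in>J. s j * y j\<bar> \<le> (\<Sum>j\<in>J. \<bar>s j * y j\<bar>)" by (rule sum_abs)
  also have "\<dots> = (\<Sum>j\<in>J. \<bar>y j\<bar>)" using s by (simp add: abs_mult)
  finally have "\<bar>\<Sum>j\<in>J. s j * y j\<bar> / sum \<beta> J \<le> (\<Sum>j\<in>J. \<bar>y j\<bar>) / sum \<beta> J"
    using S by (simp add: divide_right_mono)
  also have "\<dots> = (\<Sum>j\<in>J. (\<beta> j / sum \<beta> J) *\<^sub>R (\<bar>y j\<bar> / \<beta> j))"
    unfolding sum_divide_distrib
    by (rule sum.cong) (use \<beta> in \<open>auto dest: less_imp_neq[THEN not_sym]\<close>)
  finally have "\<psi> (\<bar>\<Sum>j\<in>J. s j * y j\<bar> / sum \<beta> J) \<le> \<psi> (\<Sum>j\<in>J. (\<beta> j / sum \<beta> J) *\<^sub>R (\<bar>y j\<bar> / \<beta> j))"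
    using S by (intro orlicz_mono[OF \<psi>]) (simp_all add: divide_nonneg_pos)
  also have "\<dots> \<le> (\<Sum>j\<in>J. (\<beta> j / sum \<beta> J) * \<psi> (\<bar>y j\<bar> / \<beta> j))"
  proof (rule convex_on_sum[OF assms(2,3)])
    show "convex_on {0..} \<psi>" using \<psi> by (simp add: orlicz_def)
    show "(\<Sum>j\<in>J. \<beta> j / sum \<beta> J) = 1" using S by (simp add: sum_divide_distrib[symmetric])
  qed (use weight scaled in auto)
  finally show ?thesis .
qed

lemma integral_modular_sum_le:
  assumes "open \<Omega>" and \<psi>: "orlicz \<psi>" and J: "finite J" "J \<noteq> {}" and \<beta>: "\<And>j. j \<in> J \<Longrightarrow> 0 < \<beta> j"
    and s: "\<And>j. j \<in> J \<Longrightarrow> \<bar>s j\<bar> = 1" and v: "\<And>j. j \<in> J \<Longrightarrow> locally_integrable \<Omega> (v j)"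
  shows "integral_modular \<Omega> \<psi> (\<lambda>x. \<Sum>j\<in>J. s j * v j x) (sum \<beta> J)
    \<le> (\<Sum>j\<in>J. ennreal (\<beta> j / sum \<beta> J) * integral_modular \<Omega> \<psi> (v j) (\<beta> j))"
proof -
  have S: "0 < sum \<beta> J" using J \<beta> by (intro sum_pos) auto
  have nn: "0 \<le> \<psi> (\<bar>v j x\<bar> / \<beta> j)" if "j \<in> J" for j x
    using \<beta>[OF that] by (intro orlicz_nonneg[OF \<psi>]) simp
  have weight: "0 \<le> \<beta> j / sum \<beta> J" if "j \<in> J" for j
    using S \<beta>[OF that] by simp
  have "integral_modular \<Omega> \<psi> (\<lambda>x. \<Sum>j\<in>J. s j * v j x) (sum \<beta> J)
     \<le> (\<integral>\<^sup>+x. (\<Sum>j\<in>J. ennreal (\<beta> j / sum \<beta> J) * (ennreal (\<psi> (\<bar>v j x\<bar> / \<beta> j)) * indicator \<Omega> x)) \<partial>lebesgue)"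
    unfolding integral_modular_def
  proof (rule nn_integral_mono)
    fix x
    have "ennreal (\<psi> (\<bar>\<Sum>j\<in>J. s j * v j x\<bar> / sum \<beta> J))
        \<le> ennreal (\<Sum>j\<in>J. (\<beta> j / sum \<beta> J) * \<psi> (\<bar>v j x\<bar> / \<beta> j))"
      by (intro ennreal_leI orlicz_convex_combination \<psi> J \<beta> s)
    also have "\<dots> = (\<Sum>j\<in>J. ennreal ((\<beta> j / sum \<beta> J) * \<psi> (\<bar>v j x\<bar> / \<beta> j)))"
      by (rule sum_ennreal[symmetric]) (intro mult_nonneg_nonneg weight nn)
    also have "\<dots> = (\<Sum>j\<in>J. ennreal (\<beta> j / sum \<beta> J) * ennreal (\<psi> (\<bar>v j x\<bar> / \<beta> j)))"
      by (rule sum.cong[OF refl], rule ennreal_mult) (intro weight nn; assumption)+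
    finally show "ennreal (\<psi> (\<bar>\<Sum>j\<in>J. s j * v j x\<bar> / sum \<beta> J)) * indicator \<Omega> x
        \<le> (\<Sum>j\<in>J. ennreal (\<beta> j / sum \<beta> J) * (ennreal (\<psi> (\<bar>v j x\<bar> / \<beta> j)) * indicator \<Omega> x))"
      by (cases "x \<in> \<Omega>") simp_all
  qed
  also have "\<dots> = (\<Sum>j\<in>J. ennreal (\<beta> j / sum \<beta> J) * integral_modular \<Omega> \<psi> (v j) (\<beta> j))"
  proof -
    have m: "(\<lambda>x. ennreal (\<psi> (\<bar>v j x\<bar> / \<beta> j)) * indicator \<Omega> x) \<in> borel_measurable lebesgue" if "j \<in> J" for j
      by (intro integrand_measurable \<open>open \<Omega>\<close> \<psi> v \<beta> that)
    show ?thesis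
      unfolding integral_modular_def
      by (subst nn_integral_sum) (auto intro!: sum.cong nn_integral_cmult borel_measurable_times_ennreal m)
  qed
  finally show ?thesis .
qed

text \<open>The triangle inequality for the Luxemburg norm at the level of modulars: the modular of the signed sum
  is at most the average of the given modulars with weights \<open>\<beta>\<^sub>j / \<Sum>\<^sub>j \<beta>\<^sub>j\<close>.\<close>

lemma modular_sum_le_1:
  fixes \<Omega> :: "'n::{finite,linorder} euclid set"
  assumes "open \<Omega>" and \<psi>: "orlicz \<psi>" and J: "finite J" "J \<noteq> {}" and \<beta>: "\<And>j. j \<in> J \<Longrightarrow> 0 < \<beta> j"
    and s: "\<And>j. j \<in> J \<Longrightarrow> \<bar>s j\<bar> = 1"
    and w: "\<And>j \<alpha>. j \<in> J \<Longrightarrow> order_of \<alpha> \<le> k \<Longrightarrow> has_weak_deriv \<Omega> \<alpha> (w j) (v j \<alpha>)"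
    and le: "\<And>j. j \<in> J \<Longrightarrow> modular \<Omega> \<psi> k (w j) (\<beta> j) \<le> 1"
  shows "modular \<Omega> \<psi> k (\<lambda>x. \<Sum>j\<in>J. s j * w j x) (sum \<beta> J) \<le> 1"
proof -
  have S: "0 < sum \<beta> J" using J \<beta> by (intro sum_pos) auto
  have li: "locally_integrable \<Omega> (v j \<alpha>)" if "j \<in> J" "order_of \<alpha> \<le> k" for j \<alpha>
    using w[OF that] by (simp add: has_weak_deriv_def)
  have "has_weak_deriv \<Omega> \<alpha> (\<lambda>x. \<Sum>j\<in>J. s j * w j x) (\<lambda>x. \<Sum>j\<in>J. s j * v j \<alpha> x)" if "order_of \<alpha> \<le> k" for \<alpha>
    by (intro has_weak_deriv_sum has_weak_deriv_cmult w that)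
  then have "modular \<Omega> \<psi> k (\<lambda>x. \<Sum>j\<in>J. s j * w j x) (sum \<beta> J)
      = (\<Sum>\<alpha> | order_of \<alpha> \<le> k. integral_modular \<Omega> \<psi> (\<lambda>x. \<Sum>j\<in>J. s j * v j \<alpha> x) (sum \<beta> J))"
    by (rule modular_eq[OF \<open>open \<Omega>\<close>])
  also have "\<dots> \<le> (\<Sum>\<alpha> | order_of \<alpha> \<le> k. \<Sum>j\<in>J. ennreal (\<beta> j / sum \<beta> J) * integral_modular \<Omega> \<psi> (v j \<alpha>) (\<beta> j))"
    by (rule sum_mono) (use li in \<open>auto intro!: integral_modular_sum_le \<open>open \<Omega>\<close> \<psi> J \<beta> s\<close>)
  also have "\<dots> = (\<Sum>j\<in>J. ennreal (\<beta> j / sum \<beta> J) * (\<Sum>\<alpha> | order_of \<alpha> \<le> k. integral_modular \<Omega> \<psi> (v j \<alpha>) (\<beta> j)))"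
    by (subst sum.swap) (simp add: sum_distrib_left)
  also have "\<dots> = (\<Sum>j\<in>J. ennreal (\<beta> j / sum \<beta> J) * modular \<Omega> \<psi> k (w j) (\<beta> j))"
    by (rule sum.cong[OF refl], subst modular_eq[OF \<open>open \<Omega>\<close> w]) auto
  also have "\<dots> \<le> (\<Sum>j\<in>J. ennreal (\<beta> j / sum \<beta> J) * 1)"
    by (intro sum_mono mult_left_mono le) auto
  also have "\<dots> = ennreal (\<Sum>j\<in>J. \<beta> j / sum \<beta> J)"
    by (simp, rule sum_ennreal) (use \<beta> S in \<open>auto intro!: divide_nonneg_pos less_imp_le\<close>)
  also have "\<dots> = 1" using S by (simp add: sum_divide_distrib[symmetric])
  finally show ?thesis .
qed

text \<open>The derivatives of \<open>\<partial>\<^sub>j u\<close> up to order \<open>k\<close> are those of \<open>u\<close> with the distinct indices \<open>\<alpha> + j\<close>, all of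
  order at most \<open>k + 1\<close>; the other terms on the right are nonnegative.\<close>

lemma modular_first_derivative_le:
  fixes \<Omega> :: "'n::{finite,linorder} euclid set"
  assumes "open \<Omega>" and v: "\<And>\<alpha>. order_of \<alpha> \<le> Suc k \<Longrightarrow> has_weak_deriv \<Omega> \<alpha> u (v \<alpha>)"
  shows "modular \<Omega> \<psi> k (v (unit_index j)) \<beta> \<le> modular \<Omega> \<psi> (Suc k) u \<beta>"
proof -
  let ?\<tau> = "\<lambda>\<alpha>. (\<lambda>i. \<alpha> i + unit_index j i)"
  have unit: "order_of (unit_index j) \<le> Suc k" by (simp add: unit_index_def)
  have "modular \<Omega> \<psi> k (v (unit_index j)) \<beta> = (\<Sum>\<alpha> | order_of \<alpha> \<le> k. integral_modular \<Omega> \<psi> (v (?\<tau> \<alpha>)) \<beta>)"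
    by (rule modular_eq[OF \<open>open \<Omega>\<close>], rule has_weak_deriv_first_order_then[OF v[OF unit] v])
      (simp only: order_of_add_unit Suc_le_mono)
  also have "\<dots> = (\<Sum>\<alpha>\<in>?\<tau> ` {\<alpha>. order_of \<alpha> \<le> k}. integral_modular \<Omega> \<psi> (v \<alpha>) \<beta>)"
  proof -
    have "inj_on ?\<tau> {\<alpha>. order_of \<alpha> \<le> k}" by (rule inj_onI) (simp add: fun_eq_iff)
    then show ?thesis by (simp add: sum.reindex)
  qed
  also have "\<dots> \<le> (\<Sum>\<alpha> | order_of \<alpha> \<le> Suc k. integral_modular \<Omega> \<psi> (v \<alpha>) \<beta>)"
  proof (rule sum_mono2[OF finite_multi_indices])
    show "?\<tau> ` {\<alpha>. order_of \<alpha> \<le> k} \<subseteq> {\<alpha>. order_of \<alpha> \<le> Suc k}"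
      using order_of_add_unit[of _ j] by (auto simp del: sum.distrib)
  qed simp
  also have "\<dots> = modular \<Omega> \<psi> (Suc k) u \<beta>"
    by (rule modular_eq[OF \<open>open \<Omega>\<close> v, symmetric])
  finally show ?thesis .
qed

lemma orlicz_contract:
  assumes "orlicz \<psi>" "0 \<le> x" "1 \<le> t"
  shows "\<psi> (x / t) \<le> \<psi> x / t"
proof -
  have "\<psi> ((1 - 1 / t) *\<^sub>R 0 + (1 / t) *\<^sub>R x) \<le> (1 - 1 / t) * \<psi> 0 + (1 / t) * \<psi> x"
    by (rule convex_onD[of "{0..}"]) (use assms in \<open>auto simp: orlicz_def\<close>)
  then show ?thesis using assms by (simp add: orlicz_def)
qed

text \<open>By convexity and \<open>\<psi> 0 = 0\<close>, multiplying \<open>\<beta>\<close> by \<open>t \<ge> 1\<close> divides the modular by at least \<open>t\<close>.  Hence the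
  infimum in the Luxemburg norm ranges over a nonempty set as soon as some modular is finite.\<close>

lemma modular_le_1_exists:
  fixes \<Omega> :: "'n::{finite,linorder} euclid set"
  assumes "open \<Omega>" and \<psi>: "orlicz \<psi>" and v: "\<And>\<alpha>. order_of \<alpha> \<le> k \<Longrightarrow> has_weak_deriv \<Omega> \<alpha> u (v \<alpha>)"
    and \<beta>: "0 < \<beta>" and fin: "modular \<Omega> \<psi> k u \<beta> < \<infinity>"
  shows "\<exists>\<beta>'>0. modular \<Omega> \<psi> k u \<beta>' \<le> 1"
proof -
  obtain M where M: "modular \<Omega> \<psi> k u \<beta> = ennreal M"
    using fin by (cases "modular \<Omega> \<psi> k u \<beta>") auto
  define t where "t = max 1 M"
  have t: "1 \<le> t" "M \<le> t" by (auto simp: t_def)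
  have eq: "modular \<Omega> \<psi> k u b = (\<Sum>\<alpha> | order_of \<alpha> \<le> k. integral_modular \<Omega> \<psi> (v \<alpha>) b)" for b
    by (rule modular_eq[OF \<open>open \<Omega>\<close> v])
  have "modular \<Omega> \<psi> k u (\<beta> * t) \<le> ennreal (1 / t) * modular \<Omega> \<psi> k u \<beta>"
    unfolding eq sum_distrib_left
  proof (rule sum_mono)
    fix \<alpha> :: "'n multi_index" assume "\<alpha> \<in> {\<alpha>. order_of \<alpha> \<le> k}"
    then have li: "locally_integrable \<Omega> (v \<alpha>)"
      using v[of \<alpha>] by (simp add: has_weak_deriv_def)
    have "integral_modular \<Omega> \<psi> (v \<alpha>) (\<beta> * t)
        \<le> (\<integral>\<^sup>+x. ennreal (1 / t) * (ennreal (\<psi> (\<bar>v \<alpha> x\<bar> / \<beta>)) * indicator \<Omega> x) \<partial>lebesgue)"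
      unfolding integral_modular_def
    proof (rule nn_integral_mono)
      fix x
      have y: "0 \<le> \<bar>v \<alpha> x\<bar> / \<beta>" using \<beta> by simp
      have "\<psi> (\<bar>v \<alpha> x\<bar> / (\<beta> * t)) \<le> 1 / t * \<psi> (\<bar>v \<alpha> x\<bar> / \<beta>)"
        using orlicz_contract[OF \<psi> y t(1)] by simp
      then have "ennreal (\<psi> (\<bar>v \<alpha> x\<bar> / (\<beta> * t))) \<le> ennreal (1 / t * \<psi> (\<bar>v \<alpha> x\<bar> / \<beta>))"
        by (rule ennreal_leI)
      also have "\<dots> = ennreal (1 / t) * ennreal (\<psi> (\<bar>v \<alpha> x\<bar> / \<beta>))"
        by (rule ennreal_mult) (use t orlicz_nonneg[OF \<psi> y] in auto)
      finally show "ennreal (\<psi> (\<bar>v \<alpha> x\<bar> / (\<beta> * t))) * indicator \<Omega> x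
          \<le> ennreal (1 / t) * (ennreal (\<psi> (\<bar>v \<alpha> x\<bar> / \<beta>)) * indicator \<Omega> x)"
        by (cases "x \<in> \<Omega>") simp_all
    qed
    also have "\<dots> = ennreal (1 / t) * integral_modular \<Omega> \<psi> (v \<alpha>) \<beta>"
      unfolding integral_modular_def
      by (rule nn_integral_cmult[OF integrand_measurable[OF \<open>open \<Omega>\<close> \<psi> li \<beta>]])
    finally show "integral_modular \<Omega> \<psi> (v \<alpha>) (\<beta> * t) \<le> ennreal (1 / t) * integral_modular \<Omega> \<psi> (v \<alpha>) \<beta>" .
  qed
  also have "\<dots> \<le> ennreal (1 / t) * ennreal t"
    unfolding M using t by (intro mult_left_mono ennreal_leI) auto
  also have "\<dots> = 1"
    using t by (simp flip: ennreal_mult)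
  finally show ?thesis
    using \<beta> t by (intro exI[of _ "\<beta> * t"]) auto
qed


section \<open>The Luxemburg norm\<close>

lemma luxemburg_norm_le:
  "0 < \<beta> \<Longrightarrow> modular \<Omega> \<psi> k u \<beta> \<le> 1 \<Longrightarrow> luxemburg_norm k \<psi> \<Omega> u \<le> \<beta>"
  unfolding luxemburg_norm_def by (rule cInf_lower) (auto intro!: bdd_belowI[of _ 0])

lemma luxemburg_norm_approx:
  assumes "\<exists>\<beta>>0. modular \<Omega> \<psi> k u \<beta> \<le> 1" and "0 < \<epsilon>"
  obtains \<beta> where "0 < \<beta>" "\<beta> < luxemburg_norm k \<psi> \<Omega> u + \<epsilon>" "modular \<Omega> \<psi> k u \<beta> \<le> 1"
proof -
  have "Inf {\<beta>. 0 < \<beta> \<and> modular \<Omega> \<psi> k u \<beta> \<le> 1} < luxemburg_norm k \<psi> \<Omega> u + \<epsilon>"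
    using assms(2) by (simp add: luxemburg_norm_def)
  then have "\<exists>\<beta>\<in>{\<beta>. 0 < \<beta> \<and> modular \<Omega> \<psi> k u \<beta> \<le> 1}. \<beta> < luxemburg_norm k \<psi> \<Omega> u + \<epsilon>"
    by (rule cInf_lessD[rotated]) (use assms(1) in auto)
  then show ?thesis using that by blast
qed

text \<open>Choose \<open>\<beta>\<^sub>j\<close> within \<open>\<epsilon> / card J\<close> of the infimum that defines the norm of \<open>w\<^sub>j\<close>, and use
  \<open>\<Sum>\<^sub>j \<beta>\<^sub>j\<close> for the sum.\<close>

lemma luxemburg_norm_sum_le:
  fixes \<Omega> :: "'n::{finite,linorder} euclid set"
  assumes "open \<Omega>" and \<psi>: "orlicz \<psi>" and J: "finite J" "J \<noteq> {}"
    and s: "\<And>j. j \<in> J \<Longrightarrow> \<bar>s j\<bar> = 1"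
    and w: "\<And>j \<alpha>. j \<in> J \<Longrightarrow> order_of \<alpha> \<le> k \<Longrightarrow> has_weak_deriv \<Omega> \<alpha> (w j) (v j \<alpha>)"
    and fin: "\<And>j. j \<in> J \<Longrightarrow> \<exists>\<beta>>0. modular \<Omega> \<psi> k (w j) \<beta> \<le> 1"
  shows "luxemburg_norm k \<psi> \<Omega> (\<lambda>x. \<Sum>j\<in>J. s j * w j x) \<le> (\<Sum>j\<in>J. luxemburg_norm k \<psi> \<Omega> (w j))"
proof (rule field_le_epsilon)
  fix \<epsilon> :: real assume \<epsilon>: "0 < \<epsilon>"
  define \<delta> where "\<delta> = \<epsilon> / card J"
  have \<delta>: "0 < \<delta>" using \<epsilon> J by (simp add: \<delta>_def card_gt_0_iff)
  have "\<exists>\<beta>>0. \<beta> < luxemburg_norm k \<psi> \<Omega> (w j) + \<delta> \<and> modular \<Omega> \<psi> k (w j) \<beta> \<le> 1" if "j \<in> J" for j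
    by (rule luxemburg_norm_approx[OF fin[OF that] \<delta>]) blast
  then obtain \<beta> where \<beta>: "\<And>j. j \<in> J \<Longrightarrow> 0 < \<beta> j"
    "\<And>j. j \<in> J \<Longrightarrow> \<beta> j < luxemburg_norm k \<psi> \<Omega> (w j) + \<delta>"
    "\<And>j. j \<in> J \<Longrightarrow> modular \<Omega> \<psi> k (w j) (\<beta> j) \<le> 1"
    by metis
  have "luxemburg_norm k \<psi> \<Omega> (\<lambda>x. \<Sum>j\<in>J. s j * w j x) \<le> sum \<beta> J"
  proof (rule luxemburg_norm_le)
    show "0 < sum \<beta> J" using J \<beta>(1) by (intro sum_pos)
    show "modular \<Omega> \<psi> k (\<lambda>x. \<Sum>j\<in>J. s j * w j x) (sum \<beta> J) \<le> 1"
      by (rule modular_sum_le_1[OF \<open>open \<Omega>\<close> \<psi> J \<beta>(1) s w \<beta>(3)])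
  qed
  also have "\<dots> \<le> (\<Sum>j\<in>J. luxemburg_norm k \<psi> \<Omega> (w j) + \<delta>)"
    by (intro sum_mono less_imp_le \<beta>(2))
  also have "\<dots> = (\<Sum>j\<in>J. luxemburg_norm k \<psi> \<Omega> (w j)) + \<epsilon>"
    using J by (simp add: sum.distrib \<delta>_def card_gt_0_iff)
  finally show "luxemburg_norm k \<psi> \<Omega> (\<lambda>x. \<Sum>j\<in>J. s j * w j x)
      \<le> (\<Sum>j\<in>J. luxemburg_norm k \<psi> \<Omega> (w j)) + \<epsilon>" .
qed

lemma luxemburg_norm_first_derivative_le:
  fixes \<Omega> :: "'n::{finite,linorder} euclid set"
  assumes "open \<Omega>" and v: "\<And>\<alpha>. order_of \<alpha> \<le> Suc k \<Longrightarrow> has_weak_deriv \<Omega> \<alpha> u (v \<alpha>)"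
    and fin: "\<exists>\<beta>>0. modular \<Omega> \<psi> (Suc k) u \<beta> \<le> 1"
  shows "luxemburg_norm k \<psi> \<Omega> (v (unit_index j)) \<le> luxemburg_norm (Suc k) \<psi> \<Omega> u"
proof (rule field_le_epsilon)
  fix \<epsilon> :: real assume \<epsilon>: "0 < \<epsilon>"
  obtain \<beta> where \<beta>: "0 < \<beta>" "\<beta> < luxemburg_norm (Suc k) \<psi> \<Omega> u + \<epsilon>" "modular \<Omega> \<psi> (Suc k) u \<beta> \<le> 1"
    by (rule luxemburg_norm_approx[OF fin \<epsilon>])
  have "luxemburg_norm k \<psi> \<Omega> (v (unit_index j)) \<le> \<beta>"
    using modular_first_derivative_le[OF \<open>open \<Omega>\<close> v] \<beta>(3)
    by (intro luxemburg_norm_le \<beta>(1)) (blast intro: order_trans)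
  then show "luxemburg_norm k \<psi> \<Omega> (v (unit_index j)) \<le> luxemburg_norm (Suc k) \<psi> \<Omega> u + \<epsilon>"
    using \<beta>(2) by simp
qed


section \<open>The Dirac operator\<close>

lemma locally_integrable_componentwise:
  fixes f :: "'n::finite euclid \<Rightarrow> real ^ 'm"
  assumes "\<And>i. locally_integrable \<Omega> (\<lambda>x. f x $ i)"
  shows "locally_integrable \<Omega> f"
proof -
  have "locally_integrable \<Omega> (\<lambda>x. \<Sum>i\<in>UNIV. (f x $ i) *\<^sub>R axis i (1::real))"
    by (intro locally_integrable_sum locally_integrable_bounded_linear[OF bounded_linear_scaleR_left] assms)
  moreover have "(\<lambda>x. \<Sum>i\<in>UNIV. (f x $ i) *\<^sub>R axis i 1) = f"
    using basis_expansion[of "f _"] by (simp add: fun_eq_iff scalar_mult_eq_scaleR)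
  ultimately show ?thesis by (simp only:)
qed

text \<open>Symmetric difference with \<open>{j}\<close> is an involution, so exactly one basis vector, that of index
  \<open>{j} \<triangle> B\<close>, is sent by \<open>e\<^sub>j\<close> to a multiple of \<open>e\<^sub>B\<close>.\<close>

lemma cl_gen_mult_component:
  "(cl_gen j \<odot> y) $ B = cl_sign {j} (sym_diff {j} B) * y $ (sym_diff {j} B)"
proof -
  have flip: "sym_diff {j} C = B \<longleftrightarrow> C = sym_diff {j} B" for C by auto
  have "(cl_gen j \<odot> y) $ B
      = (\<Sum>A\<in>UNIV. if A = {j} then (\<Sum>C\<in>UNIV. y $ C * cl_sign A C * axis (sym_diff A C) 1 $ B) else 0)"
    unfolding cl_mult_def cl_gen_def sum_component
    by (rule sum.cong[OF refl]) (simp add: axis_def[of "{j}"] if_distrib if_distribR cong: if_cong)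
  also have "\<dots> = (\<Sum>C\<in>UNIV. y $ C * cl_sign {j} C * axis (sym_diff {j} C) 1 $ B)"
    by simp
  also have "\<dots> = (\<Sum>C\<in>UNIV. if C = sym_diff {j} B then y $ C * cl_sign {j} C else 0)"
    unfolding axis_def vec_lambda_beta
    by (rule sum.cong[OF refl]) (use flip in auto)
  finally show ?thesis by simp
qed

lemma dirac_component:
  "dirac \<Omega> f x $ B = (\<Sum>j\<in>UNIV. cl_sign {j} (sym_diff {j} B) *
     weak_deriv \<Omega> (unit_index j) (\<lambda>y. f y $ sym_diff {j} B) x)"
proof -
  have "cl_weak_partial \<Omega> j f x $ A = weak_deriv \<Omega> (unit_index j) (\<lambda>y. f y $ A) x" for j A
    by (simp add: cl_weak_partial_def sum_component axis_def if_distrib cong: if_cong)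
  then show ?thesis
    by (simp only: dirac_def sum_component cl_gen_mult_component)
qed

lemma abs_cl_sign: "\<bar>cl_sign A B\<bar> = 1"
  by (simp add: cl_sign_def power_abs)

text \<open>The norm estimate is first proved for each component \<open>B\<close>.  For fixed \<open>j\<close> the indices \<open>{j} \<triangle> B\<close> run once
  through all subsets, so summing over \<open>B\<close> reproduces the full norm of \<open>f\<close> once for each of the \<open>n\<close>
  generators.\<close>

lemma dirac_orlicz_sobolev:
  fixes \<Omega> :: "'n::{finite,linorder} euclid set"
  assumes "open \<Omega>" and \<psi>: "orlicz \<psi>" and f: "f \<in> orlicz_sobolev (Suc k) \<psi> \<Omega>"
  shows "dirac \<Omega> f \<in> orlicz_sobolev k \<psi> \<Omega>"
    and "orlicz_sobolev_norm k \<psi> \<Omega> (dirac \<Omega> f) \<le> real CARD('n) * orlicz_sobolev_norm (Suc k) \<psi> \<Omega> f"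
proof -
  define v where "v A \<alpha> = weak_deriv \<Omega> \<alpha> (\<lambda>x. f x $ A)" for A \<alpha>
  have v: "has_weak_deriv \<Omega> \<alpha> (\<lambda>x. f x $ A) (v A \<alpha>)" if "order_of \<alpha> \<le> Suc k" for A \<alpha>
    using f that has_weak_deriv_weak_deriv unfolding orlicz_sobolev_def v_def by blast
  have fin: "\<exists>\<beta>>0. modular \<Omega> \<psi> (Suc k) (\<lambda>x. f x $ A) \<beta> \<le> 1" for A
  proof -
    obtain \<beta> where \<beta>: "0 < \<beta>" "modular \<Omega> \<psi> (Suc k) (\<lambda>x. f x $ A) \<beta> < \<infinity>"
      using f unfolding orlicz_sobolev_def by blast
    show ?thesis by (rule modular_le_1_exists[OF \<open>open \<Omega>\<close> \<psi> v \<beta>])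
  qed
  have unit: "order_of (unit_index j) \<le> Suc k" for j :: 'n by (simp add: unit_index_def)
  have D: "has_weak_deriv \<Omega> \<alpha> (v A (unit_index j)) (v A (\<lambda>i. \<alpha> i + unit_index j i))"
    if "order_of \<alpha> \<le> k" for A \<alpha> j
    by (rule has_weak_deriv_first_order_then[OF v[OF unit] v]) (simp only: order_of_add_unit that Suc_le_mono)
  have finD: "\<exists>\<beta>>0. modular \<Omega> \<psi> k (v A (unit_index j)) \<beta> \<le> 1" for A j
  proof -
    obtain \<beta> where \<beta>: "0 < \<beta>" "modular \<Omega> \<psi> (Suc k) (\<lambda>x. f x $ A) \<beta> \<le> 1"
      using fin by blast
    have "modular \<Omega> \<psi> k (v A (unit_index j)) \<beta> \<le> modular \<Omega> \<psi> (Suc k) (\<lambda>x. f x $ A) \<beta>"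
      by (rule modular_first_derivative_le[OF \<open>open \<Omega>\<close> v])
    with \<beta> show ?thesis by (blast intro: order_trans)
  qed
  let ?s = "\<lambda>B j. cl_sign {j} (sym_diff {j} B)"
  let ?w = "\<lambda>B j. v (sym_diff {j} B) (unit_index j)"
  have comp: "(\<lambda>x. dirac \<Omega> f x $ B) = (\<lambda>x. \<Sum>j\<in>UNIV. ?s B j * ?w B j x)" for B
    by (simp add: dirac_component v_def)
  have weak: "has_weak_deriv \<Omega> \<alpha> (\<lambda>x. dirac \<Omega> f x $ B)
      (\<lambda>x. \<Sum>j\<in>UNIV. ?s B j * v (sym_diff {j} B) (\<lambda>i. \<alpha> i + unit_index j i) x)"
    if "order_of \<alpha> \<le> k" for \<alpha> B
    unfolding comp by (intro has_weak_deriv_sum has_weak_deriv_cmult D that)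
  have finB: "\<exists>\<beta>>0. modular \<Omega> \<psi> k (\<lambda>x. dirac \<Omega> f x $ B) \<beta> < \<infinity>" for B
  proof -
    have "\<forall>j. \<exists>b. 0 < b \<and> modular \<Omega> \<psi> k (?w B j) b \<le> 1"
      using finD by blast
    from choice[OF this] obtain \<beta>
      where \<beta>: "\<And>j. 0 < \<beta> j" "\<And>j. modular \<Omega> \<psi> k (?w B j) (\<beta> j) \<le> 1"
      by blast
    have "modular \<Omega> \<psi> k (\<lambda>x. dirac \<Omega> f x $ B) (sum \<beta> UNIV) \<le> 1"
      unfolding comp
      by (rule modular_sum_le_1[where v = "\<lambda>j \<alpha>. v (sym_diff {j} B) (\<lambda>i. \<alpha> i + unit_index j i)"])
        (use \<beta> D abs_cl_sign \<open>open \<Omega>\<close> \<psi> in auto)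
    moreover have "0 < sum \<beta> UNIV" using \<beta>(1) by (intro sum_pos) auto
    ultimately show ?thesis by (intro exI[of _ "sum \<beta> UNIV"]) (auto intro: le_less_trans)
  qed
  have "locally_integrable \<Omega> (dirac \<Omega> f)"
  proof (rule locally_integrable_componentwise)
    show "locally_integrable \<Omega> (\<lambda>x. dirac \<Omega> f x $ B)" for B
      \<comment> \<open>Having a weak derivative of order \<open>0\<close> includes local integrability.\<close>
      using weak[of "\<lambda>_. 0" B] by (simp add: has_weak_deriv_def)
  qed
  then show "dirac \<Omega> f \<in> orlicz_sobolev k \<psi> \<Omega>"
    unfolding orlicz_sobolev_def using weak finB by blast
  let ?N = "\<lambda>A. luxemburg_norm (Suc k) \<psi> \<Omega> (\<lambda>x. f x $ A)"
  have le: "luxemburg_norm k \<psi> \<Omega> (\<lambda>x. dirac \<Omega> f x $ B) \<le> (\<Sum>j\<in>UNIV. ?N (sym_diff {j} B))" for B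
  proof -
    have "luxemburg_norm k \<psi> \<Omega> (\<lambda>x. dirac \<Omega> f x $ B) \<le> (\<Sum>j\<in>UNIV. luxemburg_norm k \<psi> \<Omega> (?w B j))"
      unfolding comp
      by (rule luxemburg_norm_sum_le[where v = "\<lambda>j \<alpha>. v (sym_diff {j} B) (\<lambda>i. \<alpha> i + unit_index j i)"])
        (use finD D abs_cl_sign \<open>open \<Omega>\<close> \<psi> in auto)
    also have "\<dots> \<le> (\<Sum>j\<in>UNIV. ?N (sym_diff {j} B))"
      by (intro sum_mono luxemburg_norm_first_derivative_le \<open>open \<Omega>\<close> v fin)
    finally show ?thesis .
  qed
  have "orlicz_sobolev_norm k \<psi> \<Omega> (dirac \<Omega> f) \<le> (\<Sum>B\<in>UNIV. \<Sum>j\<in>UNIV. ?N (sym_diff {j} B))"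
    unfolding orlicz_sobolev_norm_def by (intro sum_mono le)
  also have "\<dots> = (\<Sum>j\<in>UNIV. \<Sum>B\<in>UNIV. ?N (sym_diff {j} B))" by (rule sum.swap)
  also have "\<dots> = (\<Sum>j\<in>(UNIV :: 'n set). \<Sum>A\<in>UNIV. ?N A)"
  proof (rule sum.cong[OF refl])
    fix j :: 'n
    have "sym_diff {j} (sym_diff {j} B) = B" for B by auto
    then show "(\<Sum>B\<in>UNIV. ?N (sym_diff {j} B)) = (\<Sum>A\<in>UNIV. ?N A)"
      by (intro sum.reindex_bij_witness[of _ "sym_diff {j}" "sym_diff {j}"]) simp_all
  qed
  also have "\<dots> = real CARD('n) * orlicz_sobolev_norm (Suc k) \<psi> \<Omega> f"
    by (simp add: orlicz_sobolev_norm_def)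
  finally show "orlicz_sobolev_norm k \<psi> \<Omega> (dirac \<Omega> f) \<le> real CARD('n) * orlicz_sobolev_norm (Suc k) \<psi> \<Omega> f" .
qed

theorem proposition3:
  fixes \<Omega> :: "(real ^ 'n::{finite,linorder}) set" and \<psi> :: "real \<Rightarrow> real"
  assumes "bounded_C1_domain \<Omega>" and "orlicz \<psi>"
  shows "(\<forall>k\<ge>1. \<forall>f\<in>orlicz_sobolev k \<psi> \<Omega>. dirac \<Omega> f \<in> orlicz_sobolev (k - 1) \<psi> \<Omega>) \<and>
    (\<exists>\<gamma>>0. \<forall>k\<ge>1. \<forall>f\<in>orlicz_sobolev k \<psi> \<Omega>.
       orlicz_sobolev_norm (k - 1) \<psi> \<Omega> (dirac \<Omega> f) \<le> \<gamma> * orlicz_sobolev_norm k \<psi> \<Omega> f)"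
proof (intro conjI exI[of _ "real CARD('n)"] allI impI ballI)
  have "open \<Omega>" using assms(1) by (simp add: bounded_C1_domain_def)
  note D = dirac_orlicz_sobolev[OF this assms(2)]
  fix k and f
  assume "1 \<le> k" and f: "f \<in> orlicz_sobolev k \<psi> \<Omega>"
  then have k: "k = Suc (k - 1)" by simp
  show "dirac \<Omega> f \<in> orlicz_sobolev (k - 1) \<psi> \<Omega>"
    using D(1)[of f "k - 1"] f k by simp
  show "orlicz_sobolev_norm (k - 1) \<psi> \<Omega> (dirac \<Omega> f) \<le> real CARD('n) * orlicz_sobolev_norm k \<psi> \<Omega> f"
    using D(2)[of f "k - 1"] f k by simp
qed simp

end
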